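(* Let $\rho(t,x)$, $t\ge 0$, $x\ge 0$, be a family of probability densities on $[0,\infty)$ which is a classical solution, for each $t>0$, of $$\partial_t \rho(t,x) = 2\int_0^{2x}\rho(t,y)\,\rho(t,2x-y)\,\mathrm{d}y - \rho(t,x),$$ and whose initial condition $\rho(0,\cdot)$ is a log-concave probability density on $[0,\infty)$ with mean $\mu>0$. Then the Gini index $G[\rho(t)]$ converges to $0$ exponentially fast in time; more precisely, for all $t\ge 0$, $$G[\rho(t)] \le G[\rho(0)]\, e^{-t/14434}.$$
   Context: Here $\rho(t)$ denotes the function $x\mapsto\rho(t,x)$. For a probability density $\rho$ on $\mathbb{R}_+=[0,\infty)$ with mean $\mu>0$, the Gini index is $$G[\rho]=\frac{1}{2\mu}\iint_{\mathbb{R}_+^2}\rho(x)\,\rho(y)\,|x-y|\,\mathrm{d}x\,\mathrm{d}y=\frac{1}{2\mu}\mathbb{E}[|X-Y|],$$ where $X,Y$ are i.i.d. with law $\rho$. The evolution equation preserves total mass and mean, so $\rho(t)$ has mean $\mu$ for every $t$. *)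

theory Defs
  imports "HOL-Analysis.Analysis"
begin

text \<open>
  Functions on \<open>[0,\<infinity>)\<close> are represented by functions on \<open>real\<close> whose values
  at negative arguments are never used.
\<close>

definition prob_density :: "(real \<Rightarrow> real) \<Rightarrow> bool" where
  "prob_density f \<longleftrightarrow>
     (\<forall>x\<ge>0. 0 \<le> f x) \<and> set_integrable lborel {0..} f \<and> (LBINT x:{0..}. f x) = 1"

definition mean :: "(real \<Rightarrow> real) \<Rightarrow> real" where
  "mean f = (LBINT x:{0..}. x * f x)"

definition has_mean :: "(real \<Rightarrow> real) \<Rightarrow> real \<Rightarrow> bool" where
  "has_mean f m \<longleftrightarrow> set_integrable lborel {0..} (\<lambda>x. x * f x) \<and> mean f = m"

definition gini :: "(real \<Rightarrow> real) \<Rightarrow> real" where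
  "gini f = 1 / (2 * mean f) *
     set_lebesgue_integral (lborel \<Otimes>\<^sub>M lborel) ({0..} \<times> {0..})
       (\<lambda>(x, y). f x * f y * \<bar>x - y\<bar>)"

text \<open>
  The exponents are positive, so the convention \<open>0 powr a = 0\<close> is the correct value
  at the zeros of \<open>f\<close>.
\<close>

definition log_concave :: "(real \<Rightarrow> real) \<Rightarrow> bool" where
  "log_concave f \<longleftrightarrow>
     (\<forall>x\<ge>0. 0 \<le> f x) \<and>
     (\<forall>x\<ge>0. \<forall>y\<ge>0. \<forall>\<theta>. 0 < \<theta> \<longrightarrow> \<theta> < 1 \<longrightarrow>
        f x powr (1 - \<theta>) * f y powr \<theta> \<le> f ((1 - \<theta>) * x + \<theta> * y))"

text \<open>
  The first conjunct says that the integral in the equation converges (a divergent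
  integral would have the value \<open>0\<close>); the last one says that the initial value is attained.
\<close>

definition classical_solution :: "(real \<Rightarrow> real \<Rightarrow> real) \<Rightarrow> bool" where
  "classical_solution \<rho> \<longleftrightarrow>
     (\<forall>t>0. \<forall>x\<ge>0. set_integrable lborel {0..2 * x} (\<lambda>y. \<rho> t y * \<rho> t (2 * x - y))) \<and>
     (\<forall>t>0. \<forall>x\<ge>0. ((\<lambda>s. \<rho> s x) has_real_derivative
        (2 * (LBINT y:{0..2 * x}. \<rho> t y * \<rho> t (2 * x - y)) - \<rho> t x)) (at t)) \<and>
     (\<forall>x\<ge>0. ((\<lambda>s. \<rho> s x) \<longlongrightarrow> \<rho> 0 x) (at_right 0))"

end

theory Submission
  imports Defs "HOL-Probability.Probability_Measure"
begin

text \<open>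
  Let \<open>X\<close>, \<open>X'\<close>, \<open>Y\<close> be independent with law \<open>\<rho>(t)\<close>. The equation says that the law relaxes at rate one
  towards the law of \<open>(X + X') / 2\<close>. Hence for a symmetric function \<open>\<Phi>\<close> of two points the mean of
  \<open>\<Phi>(X, Y)\<close> has the derivative \<open>- 2 * E(defect)\<close>, where the defect is
  \<open>(\<Phi>(X, Y) + \<Phi>(X', Y)) / 2 - \<Phi>((X + X') / 2, Y)\<close>; it is nonnegative if \<open>\<Phi>\<close> is midpoint convex. Three
  choices of \<open>\<Phi>\<close> are used. For \<open>x + y\<close> the defect vanishes and the mean is conserved. For \<open>(x - y)\<^sup>2\<close> the
  defect is always a quarter of the whole, so the variance decays exactly like \<open>exp (- t / 2)\<close>. For
  \<open>\<bar>x - y\<bar>\<close>, which defines the Gini index, the defect is the smaller gap if \<open>Y\<close> lies between \<open>X\<close> and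
  \<open>X'\<close>, and otherwise zero. It is not comparable to the mean distance for general laws: for a law on two
  points it vanishes.

  Let \<open>D\<close> be the mean distance at time zero. Log-concavity of the initial density \<open>f\<close>, used in the form
  \<open>f a * f (a + u + v) \<le> f (a + u) * f (a + v)\<close>, implies by integration over \<open>u\<close> and \<open>v\<close> that \<open>f\<close> is bounded
  by \<open>2 / D\<close>, and that the squared distance has mean at most \<open>648 * D\<^sup>2\<close>
  (\<open>sq_diff_le_abs_diff\<close>). The bound on \<open>f\<close> forces three independent points to be well separated with
  probability at least one half, so the initial defect has mean at least \<open>D / 144\<close>
  (\<open>defect_abs_diff_ge\<close>).

  Log-concavity is lost at positive times, but two consequences survive. Since \<open>\<rho>(t) \<ge> exp (- t) * \<rho>(0)\<close>
  pointwise, the defect at time \<open>t\<close> is at least \<open>exp (- 3 * t) * D / 144\<close>, and integration gives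
  \<open>D(t) \<le> D * (1 - (1 - exp (- 3 * t)) / 216)\<close>. Since the variance decays, \<open>D(t) \<le> 26 * D * exp (- t / 4)\<close>.
  The first estimate lies below \<open>D * exp (- t / 14434)\<close> for \<open>t \<le> 21\<close>, the second one for \<open>t \<ge> 21\<close>.

  The solution is classical only pointwise in \<open>x\<close>, and finiteness of its moments at positive times has to
  be proved. The product of two copies of \<open>exp t * \<rho>(t)\<close> has a nonnegative time derivative, so the weak form
  of the equation follows from Tonelli's theorem as an identity in \<open>[0, \<infinity>]\<close> (\<open>midpoint_flow\<close>). The
  moments are then controlled by their truncations (\<open>pair_mean_nonincreasing\<close>).
\<close>

section \<open>Integral inequalities of Gronwall type\<close>

lemma integrable_on_Icc_bounded:
  fixes u :: "real \<Rightarrow> real"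
  assumes [measurable]: "u \<in> borel_measurable borel"
    and bound: "\<And>s. s \<in> {a..b} \<Longrightarrow> \<bar>u s\<bar> \<le> K"
  shows "u integrable_on {a..b}"
proof -
  have "integrable lborel (\<lambda>s. indicator {a..b} s *\<^sub>R u s)"
  proof (rule integrableI_bounded_set[where A="{a..b}" and B=K])
    show "AE s in lborel. s \<in> {a..b} \<longrightarrow> norm (indicator {a..b} s *\<^sub>R u s) \<le> K"
      using bound by auto
  qed (auto simp: emeasure_lborel_Icc_eq)
  then have "set_integrable lborel {a..b} u"
    by (simp add: set_integrable_def)
  then show ?thesis
    by (rule set_borel_integral_eq_integral(1))
qed

lemma nn_integral_Icc_eq_integral:
  fixes u :: "real \<Rightarrow> real"
  assumes "u \<in> borel_measurable borel"
    and "\<And>s. s \<in> {a..b} \<Longrightarrow> 0 \<le> u s" and "\<And>s. s \<in> {a..b} \<Longrightarrow> u s \<le> K"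
  shows "(\<integral>\<^sup>+s. ennreal (u s) * indicator {a..b} s \<partial>lborel) = ennreal (integral {a..b} u)"
proof -
  have "u integrable_on {a..b}"
    by (rule integrable_on_Icc_bounded[where K=K]) (use assms in \<open>auto simp: abs_le_iff intro: order_trans[of _ 0]\<close>)
  then show ?thesis
    by (intro nn_integral_has_integral_lebesgue' integrable_integral) (use assms in auto)
qed

text \<open>
  A Gronwall inequality in which each function is controlled by the next one of the sequence.
  Unrolling it \<open>m\<close> times gives the bound \<open>A * B ^ (n + m) * (k * t) ^ m / fact m\<close>, so the functions
  may even grow geometrically with the index: the factorial wins. The growing case is what allows
  truncated moments to be compared with moments truncated at twice the height; a constant sequence
  gives the usual inequality.
\<close>

lemma gronwall_cascade:
  fixes w :: "nat \<Rightarrow> real \<Rightarrow> real"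
  assumes int: "\<And>n t. t \<in> {0..T} \<Longrightarrow> w n integrable_on {0..t}"
    and bound: "\<And>n t. t \<in> {0..T} \<Longrightarrow> w n t \<le> A * B ^ n"
    and step: "\<And>n t. t \<in> {0..T} \<Longrightarrow> w n t \<le> k * integral {0..t} (w (Suc n))"
    and nonneg: "0 \<le> k"
    and t: "t \<in> {0..T}"
  shows "w n t \<le> 0"
proof -
  have iterate: "w n t \<le> A * B ^ (n + m) * (k * t) ^ m / fact m" if "t \<in> {0..T}" for m n t
    using that
  proof (induction m arbitrary: n t)
    case 0
    then show ?case using bound by simp
  next
    case (Suc m)
    define C where "C = A * B ^ (Suc n + m) * k ^ m / fact m"
    have pow: "((\<lambda>s. C * s ^ m) has_integral C * (t ^ Suc m / Suc m - 0 ^ Suc m / Suc m)) {0..t}"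
    proof (intro has_integral_mult_right fundamental_theorem_of_calculus)
      show "((\<lambda>s. s ^ Suc m / real (Suc m)) has_vector_derivative s ^ m) (at s within {0..t})" for s
        unfolding has_real_derivative_iff_has_vector_derivative[symmetric]
        by (rule derivative_eq_intros refl | simp)+
    qed (use Suc.prems in auto)
    have "w n t \<le> k * integral {0..t} (w (Suc n))"
      using step Suc.prems by blast
    also have "integral {0..t} (w (Suc n)) \<le> C * (t ^ Suc m / Suc m - 0 ^ Suc m / Suc m)"
    proof (rule has_integral_le[OF integrable_integral[OF int[OF Suc.prems]] pow])
      fix s assume "s \<in> {0..t}"
      then show "w (Suc n) s \<le> C * s ^ m"
        using Suc.IH[of s "Suc n"] Suc.prems by (simp add: C_def power_mult_distrib mult_ac)
    qed
    finally have "w n t \<le> k * (C * (t ^ Suc m / Suc m - 0 ^ Suc m / Suc m))"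
      using nonneg by (simp add: mult_left_mono)
    then show ?case
      by (simp add: C_def power_mult_distrib mult_ac)
  qed
  have "(\<lambda>m. A * B ^ (n + m) * (k * t) ^ m / fact m) \<longlonglongrightarrow> 0"
    using tendsto_mult_right_zero[OF summable_LIMSEQ_zero[OF summable_exp[of "B * (k * t)"]], of "A * B ^ n"]
    by (simp add: divide_inverse power_add power_mult_distrib mult_ac)
  then show ?thesis
    by (rule LIMSEQ_le_const) (use iterate[OF t] in blast)
qed

text \<open>
  The right-hand side solves \<open>h' = k * h - g * exp (- t)\<close>, \<open>h 0 = a\<close>, so the difference \<open>H - h\<close>
  satisfies the homogeneous inequality.
\<close>

lemma integral_gronwall_exp:
  fixes H :: "real \<Rightarrow> real"
  assumes meas: "H \<in> borel_measurable borel"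
    and bound: "\<And>s. s \<in> {0..T} \<Longrightarrow> \<bar>H s\<bar> \<le> K"
    and step: "\<And>t. t \<in> {0..T} \<Longrightarrow> H t \<le> a + integral {0..t} (\<lambda>s. k * H s - g * exp (- s))"
    and k: "0 \<le> k" and t: "t \<in> {0..T}"
  shows "H t \<le> a * exp (k * t) - g * (exp (k * t) - exp (- t)) / (k + 1)"
proof -
  define c where "c = g / (k + 1)"
  have g: "g = c * (k + 1)" using k by (simp add: c_def)
  define h where "h s = a * exp (k * s) - c * (exp (k * s) - exp (- s))" for s
  have h_cont: "continuous_on S h" for S
    unfolding h_def by (intro continuous_intros)
  have h_int: "((\<lambda>s. k * h s - g * exp (- s)) has_integral h t - a) {0..t}" if "t \<in> {0..T}" for t
  proof -
    have "((\<lambda>s. k * h s - g * exp (- s)) has_integral h t - h 0) {0..t}"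
    proof (intro fundamental_theorem_of_calculus)
      show "(h has_vector_derivative k * h s - g * exp (- s)) (at s within {0..t})" for s
        unfolding has_real_derivative_iff_has_vector_derivative[symmetric] h_def g
        by (rule derivative_eq_intros refl | simp add: algebra_simps)+
    qed (use that in auto)
    then show ?thesis by (simp add: h_def)
  qed
  obtain K' where K': "\<And>s. s \<in> {0..T} \<Longrightarrow> \<bar>h s\<bar> \<le> K'"
    using compact_imp_bounded[OF compact_continuous_image[OF h_cont[of "{0..T}"] compact_Icc]]
    unfolding bounded_iff by (metis imageI real_norm_def)
  have H_int: "H integrable_on {0..t}" if "t \<in> {0..T}" for t
    by (rule integrable_on_Icc_bounded[OF meas, where K=K]) (use bound that in auto)
  have h_int': "h integrable_on {0..t}" for t
    by (intro integrable_continuous_interval h_cont)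
  have "H t - h t \<le> 0"
  proof (rule gronwall_cascade[where w="\<lambda>_ s. H s - h s" and n=0 and T=T and A="K + K'" and B=1 and k=k])
    fix t assume t: "t \<in> {0..T}"
    show "(\<lambda>s. H s - h s) integrable_on {0..t}"
      using H_int[OF t] h_int' by (rule integrable_diff)
    show "H t - h t \<le> (K + K') * 1 ^ n" for n
      using bound[OF t] K'[OF t] by simp
    have H_int': "(\<lambda>s. k * H s - g * exp (- s)) integrable_on {0..t}"
      by (rule integrable_diff[OF integrable_on_mult_right[OF H_int[OF t]] integrable_continuous_interval])
        (intro continuous_intros)
    have "((\<lambda>s. (k * H s - g * exp (- s)) - (k * h s - g * exp (- s))) has_integral
        integral {0..t} (\<lambda>s. k * H s - g * exp (- s)) - (h t - a)) {0..t}"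
      by (rule has_integral_diff[OF integrable_integral[OF H_int'] h_int[OF t]])
    moreover have "((\<lambda>s. k * (H s - h s)) has_integral k * integral {0..t} (\<lambda>s. H s - h s)) {0..t}"
      by (intro has_integral_mult_right integrable_integral integrable_diff H_int h_int' t)
    ultimately have "integral {0..t} (\<lambda>s. k * H s - g * exp (- s)) - (h t - a)
        = k * integral {0..t} (\<lambda>s. H s - h s)"
      by (intro has_integral_unique) (auto simp: algebra_simps)
    then show "H t - h t \<le> k * integral {0..t} (\<lambda>s. H s - h s)"
      using step[OF t] by simp
  qed (use k t in auto)
  then show ?thesis by (simp add: h_def c_def)
qed

section \<open>Means over independent points and their midpoints\<close>

definition pair_mean :: "real measure \<Rightarrow> (real \<Rightarrow> real \<Rightarrow> real) \<Rightarrow> ennreal" where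
  "pair_mean M \<Phi> = (\<integral>\<^sup>+x. \<integral>\<^sup>+y. ennreal (\<Phi> x y) \<partial>M \<partial>M)"

definition triple_mean :: "real measure \<Rightarrow> (real \<Rightarrow> real \<Rightarrow> real \<Rightarrow> real) \<Rightarrow> ennreal" where
  "triple_mean M \<Psi> = (\<integral>\<^sup>+x. \<integral>\<^sup>+x'. \<integral>\<^sup>+y. ennreal (\<Psi> x x' y) \<partial>M \<partial>M \<partial>M)"

definition at_midpoint :: "(real \<Rightarrow> real \<Rightarrow> real) \<Rightarrow> real \<Rightarrow> real \<Rightarrow> real \<Rightarrow> real" where
  "at_midpoint \<Phi> x x' y = \<Phi> ((x + x') / 2) y"

text \<open>
  The amount by which the expected value of \<open>\<Phi>\<close> drops when one of two independent points is replaced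
  by the midpoint of two independent points.
\<close>

definition defect :: "(real \<Rightarrow> real \<Rightarrow> real) \<Rightarrow> real \<Rightarrow> real \<Rightarrow> real \<Rightarrow> real" where
  "defect \<Phi> x x' y = (\<Phi> x y + \<Phi> x' y) / 2 - at_midpoint \<Phi> x x' y"

definition symmetric_kernel :: "(real \<Rightarrow> real \<Rightarrow> real) \<Rightarrow> bool" where
  "symmetric_kernel \<Phi> \<longleftrightarrow> (\<lambda>(x, y). \<Phi> x y) \<in> borel_measurable (borel \<Otimes>\<^sub>M borel) \<and>
     (\<forall>x y. 0 \<le> \<Phi> x y) \<and> (\<forall>x y. \<Phi> x y = \<Phi> y x)"

definition midpoint_convex :: "(real \<Rightarrow> real \<Rightarrow> real) \<Rightarrow> bool" where
  "midpoint_convex \<Phi> \<longleftrightarrow> (\<forall>x x' y. \<Phi> ((x + x') / 2) y \<le> (\<Phi> x y + \<Phi> x' y) / 2)"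

lemma symmetric_kernel_measurable:
  assumes "symmetric_kernel \<Phi>" and [measurable]: "f \<in> borel_measurable N" "g \<in> borel_measurable N"
  shows "(\<lambda>z. \<Phi> (f z) (g z)) \<in> borel_measurable N"
proof -
  have "(\<lambda>z. (f z, g z)) \<in> N \<rightarrow>\<^sub>M borel \<Otimes>\<^sub>M borel" by measurable
  from measurable_compose[OF this] show ?thesis
    using assms(1) by (auto simp: symmetric_kernel_def)
qed

lemma symmetric_kernel_nonneg: "symmetric_kernel \<Phi> \<Longrightarrow> 0 \<le> \<Phi> x y"
  by (simp add: symmetric_kernel_def)

lemma symmetric_kernel_min: "symmetric_kernel \<Phi> \<Longrightarrow> 0 \<le> K \<Longrightarrow> symmetric_kernel (\<lambda>x y. min (\<Phi> x y) K)"
  by (auto simp: symmetric_kernel_def case_prod_beta intro!: borel_measurable_min)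

lemma defect_nonneg: "midpoint_convex \<Phi> \<Longrightarrow> 0 \<le> defect \<Phi> x x' y"
  by (simp add: midpoint_convex_def defect_def at_midpoint_def)

lemma defect_measurable:
  assumes "symmetric_kernel \<Phi>" and [measurable]: "f \<in> borel_measurable N" "g \<in> borel_measurable N" "h \<in> borel_measurable N"
  shows "(\<lambda>z. defect \<Phi> (f z) (g z) (h z)) \<in> borel_measurable N"
proof -
  note [measurable] = symmetric_kernel_measurable[OF assms(1)]
  show ?thesis unfolding defect_def at_midpoint_def by measurable
qed

locale real_prob_space = prob_space M for M :: "real measure" +
  assumes sets_eq_borel[measurable_cong, simp]: "sets M = sets borel"
begin

lemma triple_mean_average:
  assumes "symmetric_kernel \<Phi>"
  shows "triple_mean M (\<lambda>x x' y. (\<Phi> x y + \<Phi> x' y) / 2) = pair_mean M \<Phi>"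
proof -
  note [measurable] = symmetric_kernel_measurable[OF assms] and nonneg = symmetric_kernel_nonneg[OF assms]
  define \<phi> where "\<phi> x = (\<integral>\<^sup>+y. ennreal (\<Phi> x y / 2) \<partial>M)" for x
  have [measurable]: "\<phi> \<in> borel_measurable borel"
    unfolding \<phi>_def by measurable
  have "triple_mean M (\<lambda>x x' y. (\<Phi> x y + \<Phi> x' y) / 2) = (\<integral>\<^sup>+x. \<integral>\<^sup>+x'. \<phi> x + \<phi> x' \<partial>M \<partial>M)"
    unfolding triple_mean_def \<phi>_def add_divide_distrib
    by (simp add: ennreal_plus nonneg nn_integral_add)
  also have "\<dots> = (\<integral>\<^sup>+x. \<phi> x \<partial>M) + (\<integral>\<^sup>+x. \<phi> x \<partial>M)"
    by (simp add: nn_integral_add emeasure_space_1)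
  also have "\<dots> = (\<integral>\<^sup>+x. \<phi> x + \<phi> x \<partial>M)"
    by (simp add: nn_integral_add)
  also have "\<dots> = pair_mean M \<Phi>"
    unfolding pair_mean_def \<phi>_def
    by (simp add: nn_integral_add[symmetric] ennreal_plus[symmetric] nonneg del: ennreal_plus)
  finally show ?thesis .
qed

lemma triple_mean_at_midpoint_le:
  assumes "symmetric_kernel \<Phi>'" and "\<And>x x' y. \<Phi> ((x + x') / 2) y \<le> (\<Phi>' x y + \<Phi>' x' y) / 2"
  shows "triple_mean M (at_midpoint \<Phi>) \<le> pair_mean M \<Phi>'"
  unfolding triple_mean_average[OF assms(1), symmetric] triple_mean_def at_midpoint_def
  by (intro nn_integral_mono ennreal_leI assms(2))

text \<open>
  This identity holds between possibly infinite quantities, which is why the defect is added on the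
  left instead of being subtracted on the right.
\<close>

lemma triple_mean_at_midpoint_plus_defect:
  assumes "symmetric_kernel \<Phi>" and "midpoint_convex \<Phi>"
  shows "triple_mean M (at_midpoint \<Phi>) + triple_mean M (defect \<Phi>) = pair_mean M \<Phi>"
proof -
  note [measurable] = symmetric_kernel_measurable[OF assms(1)] and nonneg = symmetric_kernel_nonneg[OF assms(1)]
  have "triple_mean M (at_midpoint \<Phi>) + triple_mean M (defect \<Phi>)
      = triple_mean M (\<lambda>x x' y. at_midpoint \<Phi> x x' y + defect \<Phi> x x' y)"
    unfolding triple_mean_def
    using nonneg defect_nonneg[OF assms(2)]
    by (simp add: defect_def at_midpoint_def nn_integral_add[symmetric] ennreal_plus[symmetric] del: ennreal_plus)
  also have "\<dots> = pair_mean M \<Phi>"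
    unfolding triple_mean_average[OF assms(1), symmetric] by (simp add: defect_def)
  finally show ?thesis .
qed

lemma pair_mean_le_bound:
  assumes "\<And>x y. \<Phi> x y \<le> K"
  shows "pair_mean M \<Phi> \<le> ennreal K"
proof -
  have "pair_mean M \<Phi> \<le> (\<integral>\<^sup>+x. \<integral>\<^sup>+y. ennreal K \<partial>M \<partial>M)"
    unfolding pair_mean_def by (intro nn_integral_mono ennreal_leI assms)
  then show ?thesis by (simp add: emeasure_space_1)
qed

text \<open>
  The truncation heights are powers of two because midpoint convexity relates the truncation at a
  height to the one at twice that height.
\<close>

lemma pair_mean_le_of_truncations:
  assumes "symmetric_kernel \<Phi>" and le: "\<And>n::nat. pair_mean M (\<lambda>x y. min (\<Phi> x y) (2 ^ n)) \<le> c"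
  shows "pair_mean M \<Phi> \<le> c"
proof -
  note [measurable] = symmetric_kernel_measurable[OF assms(1)] and nonneg = symmetric_kernel_nonneg[OF assms(1)]
  define g where "g n x y = ennreal (min (\<Phi> x y) (2 ^ n))" for n x y
  have mono: "g n x y \<le> g m x y" if "n \<le> m" for n m x y
    using power_increasing[OF that, of "2::real"]
    unfolding g_def by (intro ennreal_leI) linarith
  have sup: "ennreal (\<Phi> x y) = (SUP n. g n x y)" for x y
  proof (rule antisym)
    obtain n where "\<Phi> x y < 2 ^ n"
      using real_arch_pow[of 2 "\<Phi> x y"] by auto
    then have "ennreal (\<Phi> x y) = g n x y" by (simp add: g_def min_absorb1)
    then show "ennreal (\<Phi> x y) \<le> (SUP n. g n x y)"
      by (metis SUP_upper UNIV_I)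
  qed (auto simp: g_def intro!: SUP_least ennreal_leI)
  have [measurable]: "g n x \<in> borel_measurable M" for n x
    unfolding g_def by measurable
  have [measurable]: "(\<lambda>x. \<integral>\<^sup>+y. g n x y \<partial>M) \<in> borel_measurable M" for n
    unfolding g_def by measurable
  have "pair_mean M \<Phi> = (\<integral>\<^sup>+x. (SUP n. \<integral>\<^sup>+y. g n x y \<partial>M) \<partial>M)"
    unfolding pair_mean_def sup
    by (intro nn_integral_cong nn_integral_monotone_convergence_SUP)
      (auto simp: incseq_def le_fun_def mono)
  also have "\<dots> = (SUP n. \<integral>\<^sup>+x. \<integral>\<^sup>+y. g n x y \<partial>M \<partial>M)"
    by (intro nn_integral_monotone_convergence_SUP)
      (auto simp: incseq_def le_fun_def intro!: nn_integral_mono mono)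
  also have "\<dots> \<le> c"
    using le by (intro SUP_least) (simp add: pair_mean_def g_def)
  finally show ?thesis .
qed

end

text \<open>
  The collision equation in weak form. The gain term of the density equation is the density of the
  midpoint of two independent points with the current law. Hence \<open>exp (2 * t)\<close> times the product of two
  copies of the density has a nonnegative time derivative, and after integration against a symmetric
  \<open>\<Phi>\<close> both factors contribute equally; this is the origin of the two factors \<open>2\<close>. The laws are indexed
  by all real times so that Borel measurability in time makes sense on the whole line.
\<close>

locale midpoint_flow =
  fixes M :: "real \<Rightarrow> real measure"
  assumes prob: "real_prob_space (M t)"
    and pair_mean_measurable: "symmetric_kernel \<Phi> \<Longrightarrow> (\<lambda>t. pair_mean (M t) \<Phi>) \<in> borel_measurable borel"
    and evolution: "symmetric_kernel \<Phi> \<Longrightarrow> 0 \<le> t \<Longrightarrow>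
      ennreal (exp (2 * t)) * pair_mean (M t) \<Phi> = pair_mean (M 0) \<Phi> +
        2 * (\<integral>\<^sup>+s. ennreal (exp (2 * s)) * triple_mean (M s) (at_midpoint \<Phi>) * indicator {0..t} s \<partial>lborel)"
begin

text \<open>
  The weak equation as an inequality between real numbers, in the form to which the Gronwall
  inequalities apply.
\<close>

lemma evolution_le:
  assumes \<Phi>: "symmetric_kernel \<Phi>" and t: "0 \<le> t" and [measurable]: "u \<in> borel_measurable borel"
    and c: "pair_mean (M 0) \<Phi> \<le> ennreal c" "0 \<le> c"
    and u: "\<And>s. s \<in> {0..t} \<Longrightarrow> 0 \<le> u s" "\<And>s. s \<in> {0..t} \<Longrightarrow> u s \<le> K"
    and le: "\<And>s. s \<in> {0..t} \<Longrightarrow> triple_mean (M s) (at_midpoint \<Phi>) \<le> ennreal (u s)"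
  shows "exp (2 * t) * enn2real (pair_mean (M t) \<Phi>) \<le> c + 2 * integral {0..t} (\<lambda>s. exp (2 * s) * u s)"
proof -
  have K: "exp (2 * s) * u s \<le> exp (2 * t) * K" if "s \<in> {0..t}" for s
    using that u[OF that] by (intro mult_mono) auto
  have int_nonneg: "0 \<le> integral {0..t} (\<lambda>s. exp (2 * s) * u s)"
    by (rule integral_nonneg[OF integrable_on_Icc_bounded[where K="exp (2 * t) * K"]])
      (use u K in auto)
  have "(\<integral>\<^sup>+s. ennreal (exp (2 * s)) * triple_mean (M s) (at_midpoint \<Phi>) * indicator {0..t} s \<partial>lborel)
      \<le> (\<integral>\<^sup>+s. ennreal (exp (2 * s) * u s) * indicator {0..t} s \<partial>lborel)"
    by (intro nn_integral_mono)
      (auto simp: ennreal_mult' intro!: mult_left_mono le split: split_indicator)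
  also have "\<dots> = ennreal (integral {0..t} (\<lambda>s. exp (2 * s) * u s))"
    by (rule nn_integral_Icc_eq_integral[where K="exp (2 * t) * K"]) (use u K in auto)
  finally have "ennreal (exp (2 * t)) * pair_mean (M t) \<Phi>
      \<le> ennreal c + 2 * ennreal (integral {0..t} (\<lambda>s. exp (2 * s) * u s))"
    unfolding evolution[OF \<Phi> t] by (intro add_mono c mult_left_mono) auto
  also have "\<dots> = ennreal (c + 2 * integral {0..t} (\<lambda>s. exp (2 * s) * u s))"
    using c int_nonneg by (simp add: ennreal_plus ennreal_mult)
  finally have "enn2real (ennreal (exp (2 * t)) * pair_mean (M t) \<Phi>)
      \<le> enn2real (ennreal (c + 2 * integral {0..t} (\<lambda>s. exp (2 * s) * u s)))"
    by (intro enn2real_mono) auto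
  then show ?thesis
    using c int_nonneg by (simp add: enn2real_mult del: ennreal_plus)
qed

text \<open>
  Formally, midpoint convexity makes the time derivative nonpositive, but this reasoning needs the
  mean at positive times to be finite, which is part of the claim. For the truncations
  \<open>min \<Phi> (2 ^ n)\<close> finiteness is clear, and although they are not midpoint convex, the midpoint value
  at level \<open>n\<close> is bounded by the average of the values at level \<open>n + 1\<close>. The bounds \<open>2 ^ n\<close> grow
  geometrically, which the cascading Gronwall inequality tolerates.
\<close>

lemma pair_mean_nonincreasing:
  assumes \<Phi>: "symmetric_kernel \<Phi>" and convex: "midpoint_convex \<Phi>" and t: "0 \<le> t"
  shows "pair_mean (M t) \<Phi> \<le> pair_mean (M 0) \<Phi>"
proof (cases "pair_mean (M 0) \<Phi> = top")
  case False
  define c where "c = enn2real (pair_mean (M 0) \<Phi>)"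
  have c: "0 \<le> c" "pair_mean (M 0) \<Phi> = ennreal c"
    using False by (auto simp: c_def less_top)
  define \<Phi>' where "\<Phi>' n = (\<lambda>x y. min (\<Phi> x y) (2 ^ n))" for n :: nat
  have \<Phi>': "symmetric_kernel (\<Phi>' n)" for n
    unfolding \<Phi>'_def by (rule symmetric_kernel_min[OF \<Phi>]) simp
  define e where "e n s = enn2real (pair_mean (M s) (\<Phi>' n))" for n s
  have le_pow: "pair_mean (M s) (\<Phi>' n) \<le> ennreal (2 ^ n)" for n s
    by (rule real_prob_space.pair_mean_le_bound[OF prob]) (simp add: \<Phi>'_def)
  have e: "ennreal (e n s) = pair_mean (M s) (\<Phi>' n)" for n s
    using le_pow[of s n] unfolding e_def
    by (intro ennreal_enn2real) (auto simp: less_top[symmetric] top_unique)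
  have e_bound: "0 \<le> e n s" "e n s \<le> 2 ^ n" for n s
    using le_pow[of s n] unfolding e[symmetric] by (auto simp: e_def)
  have e_meas[measurable]: "e n \<in> borel_measurable borel" for n
    unfolding e_def using pair_mean_measurable[OF \<Phi>'] by measurable
  have halve: "\<Phi>' n ((x + x') / 2) y \<le> (\<Phi>' (Suc n) x y + \<Phi>' (Suc n) x' y) / 2" for n x x' y
  proof -
    have "min m p \<le> (min a (2 * p) + min b (2 * p)) / 2"
      if "m \<le> (a + b) / 2" "0 \<le> a" "0 \<le> b" "0 \<le> p" for a b m p :: real
      using that by (auto simp: min_def)
    from this[of "\<Phi> ((x + x') / 2) y" "\<Phi> x y" "\<Phi> x' y" "2 ^ n"] show ?thesis
      using convex symmetric_kernel_nonneg[OF \<Phi>] by (simp add: midpoint_convex_def \<Phi>'_def)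
  qed
  have "pair_mean (M t) (\<Phi>' n) \<le> ennreal c" for n
  proof -
    have "exp (2 * t) * (e n t - c) \<le> 0"
    proof (rule gronwall_cascade[where w="\<lambda>n s. exp (2 * s) * (e n s - c)" and n=n and T=t and k=2 and A="exp (2 * t)" and B=2])
      fix n s assume s: "s \<in> {0..t}"
      show int: "(\<lambda>s. exp (2 * s) * (e n s - c)) integrable_on {0..s}" for n
      proof (rule integrable_on_Icc_bounded)
        fix r assume "r \<in> {0..s}"
        then show "\<bar>exp (2 * r) * (e n r - c)\<bar> \<le> exp (2 * s) * (2 ^ n + c)"
          using e_bound[where n=n and s=r] c(1) unfolding abs_mult by (intro mult_mono) auto
      qed measurable
      have "exp (2 * s) * (e n s - c) \<le> exp (2 * t) * 2 ^ n" if "0 \<le> e n s - c"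
        using e_bound[where n=n and s=s] c(1) that s by (intro mult_mono) auto
      moreover have "0 \<le> exp (2 * t) * (2::real) ^ n" by simp
      ultimately show "exp (2 * s) * (e n s - c) \<le> exp (2 * t) * 2 ^ n"
        by (smt (verit) mult_nonneg_nonpos exp_ge_zero)
      have init: "pair_mean (M 0) (\<Phi>' n) \<le> ennreal c"
        unfolding c(2)[symmetric] pair_mean_def \<Phi>'_def by (intro nn_integral_mono ennreal_leI) simp
      have "exp (2 * s) * e n s \<le> c + 2 * integral {0..s} (\<lambda>s. exp (2 * s) * e (Suc n) s)"
        unfolding e_def[of n]
      proof (rule evolution_le[OF \<Phi>' _ e_meas init c(1), where K="2 ^ Suc n"])
        show "triple_mean (M r) (at_midpoint (\<Phi>' n)) \<le> ennreal (e (Suc n) r)" for r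
          unfolding e by (rule real_prob_space.triple_mean_at_midpoint_le[OF prob \<Phi>' halve])
      qed (use s e_bound(1) e_bound(2)[where n="Suc n"] in auto)
      also have "integral {0..s} (\<lambda>s. exp (2 * s) * e (Suc n) s)
          = integral {0..s} (\<lambda>s. exp (2 * s) * (e (Suc n) s - c)) + c * (exp (2 * s) / 2 - 1 / 2)"
      proof (rule integral_unique)
        have "((\<lambda>r. c * exp (2 * r)) has_integral c * (exp (2 * s) / 2) - c * (exp (2 * 0) / 2)) {0..s}"
          using s by (intro fundamental_theorem_of_calculus)
            (auto simp: has_real_derivative_iff_has_vector_derivative[symmetric] intro!: derivative_eq_intros)
        from has_integral_add[OF integrable_integral[OF int[of "Suc n"]] this]
        show "((\<lambda>s. exp (2 * s) * e (Suc n) s) has_integral integral {0..s} (\<lambda>s. exp (2 * s) * (e (Suc n) s - c)) + c * (exp (2 * s) / 2 - 1 / 2)) {0..s}"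
          by (simp add: algebra_simps)
      qed
      finally show "exp (2 * s) * (e n s - c) \<le> 2 * integral {0..s} (\<lambda>s. exp (2 * s) * (e (Suc n) s - c))"
        by (simp add: algebra_simps)
    qed (use t in auto)
    then have "e n t \<le> c"
      by (simp add: mult_le_0_iff)
    then show ?thesis
      unfolding e[symmetric] by (rule ennreal_leI)
  qed
  then show ?thesis
    unfolding c(2) \<Phi>'_def by (rule real_prob_space.pair_mean_le_of_truncations[OF prob \<Phi>])
qed simp

text \<open>
  Two mechanisms of decay in one statement. A defect comparable to the current mean (the parameter
  \<open>\<alpha>\<close>) gives an exponential rate valid for all times; a defect that is only known to be at least
  \<open>g * exp (- 3 * t)\<close> gives a gain that is linear in \<open>t\<close> near \<open>0\<close> and saturates later.
\<close>

lemma pair_mean_decay: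
  assumes \<Phi>: "symmetric_kernel \<Phi>" and convex: "midpoint_convex \<Phi>" and fin: "pair_mean (M 0) \<Phi> < top"
    and \<alpha>: "0 \<le> \<alpha>" "\<alpha> \<le> 1" and g: "0 \<le> g"
    and defect: "\<And>s. 0 \<le> s \<Longrightarrow>
      ennreal (\<alpha> * enn2real (pair_mean (M s) \<Phi>) + g * exp (- 3 * s)) \<le> triple_mean (M s) (defect \<Phi>)"
    and t: "0 \<le> t"
  defines "k \<equiv> 2 * (1 - \<alpha>)"
  shows "exp (2 * t) * enn2real (pair_mean (M t) \<Phi>)
    \<le> enn2real (pair_mean (M 0) \<Phi>) * exp (k * t) - 2 * g * (exp (k * t) - exp (- t)) / (k + 1)"
proof -
  define e where "e s = enn2real (pair_mean (M s) \<Phi>)" for s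
  have e: "ennreal (e s) = pair_mean (M s) \<Phi>" if "0 \<le> s" for s
    using le_less_trans[OF pair_mean_nonincreasing[OF \<Phi> convex that] fin] by (simp add: e_def)
  have e_nonneg: "0 \<le> e s" for s
    by (simp add: e_def)
  have e_bound: "e s \<le> e 0" if "0 \<le> s" for s
    unfolding e_def by (intro enn2real_mono pair_mean_nonincreasing \<Phi> convex that fin)
  have [measurable]: "e \<in> borel_measurable borel"
    unfolding e_def using pair_mean_measurable[OF \<Phi>] by measurable
  \<comment> \<open>What remains of the current mean after the guaranteed defect has been removed.\<close>
  define u where "u s = (1 - \<alpha>) * e s - g * exp (- 3 * s)" for s
  have midpoint: "0 \<le> u s \<and> triple_mean (M s) (at_midpoint \<Phi>) \<le> ennreal (u s)" if s: "0 \<le> s" for s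
  proof -
    interpret real_prob_space "M s" by (rule prob)
    have sum: "triple_mean (M s) (at_midpoint \<Phi>) + triple_mean (M s) (defect \<Phi>) = ennreal (e s)"
      unfolding e[OF s] by (rule triple_mean_at_midpoint_plus_defect[OF \<Phi> convex])
    then obtain a d where ad: "triple_mean (M s) (at_midpoint \<Phi>) = ennreal a" "0 \<le> a"
        "triple_mean (M s) (defect \<Phi>) = ennreal d" "0 \<le> d"
      by (metis ennreal_cases ennreal_add_eq_top ennreal_neq_top)
    have "a + d = e s"
      using sum e_nonneg[of s] ad by (simp add: ennreal_plus[symmetric] del: ennreal_plus)
    moreover have "\<alpha> * e s + g * exp (- 3 * s) \<le> d"
      using defect[OF s] ad unfolding e_def[symmetric] by (simp add: ennreal_le_iff)
    ultimately have "a \<le> u s" by (simp add: u_def algebra_simps)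
    then show ?thesis using ad by (auto intro: ennreal_leI)
  qed
  have "exp (2 * t) * e t \<le> e 0 * exp (k * t) - (2 * g) * (exp (k * t) - exp (- t)) / (k + 1)"
  proof (rule integral_gronwall_exp[where T=t and K="exp (2 * t) * e 0"])
    fix s assume s: "s \<in> {0..t}"
    show "\<bar>exp (2 * s) * e s\<bar> \<le> exp (2 * t) * e 0"
      using e_bound[of s] e_nonneg[of s] s unfolding abs_mult by (intro mult_mono) auto
    have "exp (2 * s) * e s \<le> e 0 + 2 * integral {0..s} (\<lambda>s. exp (2 * s) * u s)"
      unfolding e_def[of s]
    proof (rule evolution_le[OF \<Phi>, where K="e 0"])
      show "u r \<le> e 0" if "r \<in> {0..s}" for r
      proof -
        have "(1 - \<alpha>) * e r \<le> 1 * e r"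
          using \<alpha> e_nonneg by (intro mult_right_mono) auto
        moreover have "0 \<le> g * exp (- 3 * r)" using g by simp
        ultimately show ?thesis using e_bound[of r] that by (simp add: u_def)
      qed
    qed (use s e[of 0] e_nonneg midpoint in \<open>auto simp: u_def\<close>)
    also have "2 * integral {0..s} (\<lambda>s. exp (2 * s) * u s)
        = integral {0..s} (\<lambda>s. k * (exp (2 * s) * e s) - 2 * g * exp (- s))"
      by (subst integral_mult_right[symmetric], rule integral_cong)
        (simp add: u_def k_def algebra_simps flip: exp_add)
    finally show "exp (2 * s) * e s
        \<le> e 0 + integral {0..s} (\<lambda>s. k * (exp (2 * s) * e s) - 2 * g * exp (- s))" .
  qed (use \<alpha> t in \<open>auto simp: k_def\<close>)
  then show ?thesis by (simp add: e_def)
qed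

text \<open>
  Without defect the midpoint operation is neutral. The upper bound for the mean at positive times is
  already known, so that the mean is finite and Gronwall's inequality applies to the loss
  \<open>pair_mean (M 0) \<Phi> - pair_mean (M t) \<Phi>\<close>.
\<close>

lemma pair_mean_nondecreasing:
  assumes \<Phi>: "symmetric_kernel \<Phi>" and convex: "midpoint_convex \<Phi>" and fin: "pair_mean (M 0) \<Phi> < top"
    and no_defect: "\<And>s. 0 \<le> s \<Longrightarrow> triple_mean (M s) (defect \<Phi>) = 0"
    and t: "0 \<le> t"
  shows "pair_mean (M 0) \<Phi> \<le> pair_mean (M t) \<Phi>"
proof -
  define e where "e s = enn2real (pair_mean (M s) \<Phi>)" for s
  have e: "ennreal (e s) = pair_mean (M s) \<Phi>" if "0 \<le> s" for s
    using le_less_trans[OF pair_mean_nonincreasing[OF \<Phi> convex that] fin] by (simp add: e_def)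
  have e_nonneg: "0 \<le> e s" for s
    by (simp add: e_def)
  have e_bound: "e s \<le> e 0" if "0 \<le> s" for s
    unfolding e_def by (intro enn2real_mono pair_mean_nonincreasing \<Phi> convex that fin)
  have [measurable]: "e \<in> borel_measurable borel"
    unfolding e_def using pair_mean_measurable[OF \<Phi>] by measurable
  have bound: "exp (2 * r) * e r \<le> exp (2 * t) * e 0" if "r \<in> {0..t}" for r
    using e_bound[of r] e_nonneg[of r] that by (intro mult_mono) auto
  have evol: "exp (2 * s) * e s = e 0 + 2 * integral {0..s} (\<lambda>s. exp (2 * s) * e s)"
    if s: "s \<in> {0..t}" for s
  proof -
    have int_nonneg: "0 \<le> integral {0..s} (\<lambda>s. exp (2 * s) * e s)"
      by (rule integral_nonneg[OF integrable_on_Icc_bounded[where K="exp (2 * t) * e 0"]])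
        (use e_nonneg bound s in auto)
    have "triple_mean (M r) (at_midpoint \<Phi>) = ennreal (e r)" if "0 \<le> r" for r
      using real_prob_space.triple_mean_at_midpoint_plus_defect[OF prob \<Phi> convex, of r] no_defect that e
      by simp
    then have "(\<integral>\<^sup>+r. ennreal (exp (2 * r)) * triple_mean (M r) (at_midpoint \<Phi>) * indicator {0..s} r \<partial>lborel)
        = (\<integral>\<^sup>+r. ennreal (exp (2 * r) * e r) * indicator {0..s} r \<partial>lborel)"
      by (intro nn_integral_cong) (auto simp: ennreal_mult' split: split_indicator)
    also have "\<dots> = ennreal (integral {0..s} (\<lambda>r. exp (2 * r) * e r))"
      by (rule nn_integral_Icc_eq_integral[where K="exp (2 * t) * e 0"]) (use e_nonneg bound s in auto)
    finally have "ennreal (exp (2 * s)) * ennreal (e s)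
        = ennreal (e 0) + 2 * ennreal (integral {0..s} (\<lambda>r. exp (2 * r) * e r))"
      using evolution[OF \<Phi>, of s] s e by simp
    then have "ennreal (exp (2 * s) * e s) = ennreal (e 0 + 2 * integral {0..s} (\<lambda>r. exp (2 * r) * e r))"
      using int_nonneg e_nonneg by (simp add: ennreal_mult ennreal_plus)
    then show ?thesis
      using int_nonneg e_nonneg by (subst (asm) ennreal_inj) auto
  qed
  have "- (exp (2 * t) * e t) \<le> - e 0 * exp (2 * t) - 0 * (exp (2 * t) - exp (- t)) / (2 + 1)"
  proof (rule integral_gronwall_exp[where T=t and K="exp (2 * t) * e 0"])
    fix s assume s: "s \<in> {0..t}"
    show "\<bar>- (exp (2 * s) * e s)\<bar> \<le> exp (2 * t) * e 0"
      using bound[OF s] e_nonneg[of s] by simp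
    show "- (exp (2 * s) * e s) \<le> - e 0 + integral {0..s} (\<lambda>s. 2 * - (exp (2 * s) * e s) - 0 * exp (- s))"
      using evol[OF s] by simp
  qed (use t in auto)
  then have "e 0 \<le> e t" by simp
  then show ?thesis
    using e[of 0] e[OF t] by (metis ennreal_leI order_refl)
qed

end

section \<open>Log-concave laws on the line\<close>

lemma pair_mean_triple:
  assumes "real_prob_space M" "symmetric_kernel \<Phi>"
  shows "triple_mean M (\<lambda>x x' y. \<Phi> x y) = pair_mean M \<Phi>"
    and "triple_mean M (\<lambda>x x' y. \<Phi> x' y) = pair_mean M \<Phi>"
    and "triple_mean M (\<lambda>x x' y. \<Phi> x x') = pair_mean M \<Phi>"
proof -
  interpret real_prob_space M by fact
  note [measurable] = symmetric_kernel_measurable[OF assms(2)]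
  show "triple_mean M (\<lambda>x x' y. \<Phi> x y) = pair_mean M \<Phi>"
    and "triple_mean M (\<lambda>x x' y. \<Phi> x' y) = pair_mean M \<Phi>"
    and "triple_mean M (\<lambda>x x' y. \<Phi> x x') = pair_mean M \<Phi>"
    by (simp_all add: triple_mean_def pair_mean_def emeasure_space_1)
qed

lemma (in real_prob_space) triple_mean_permute:
  assumes [measurable]: "(\<lambda>(x, x', y). g x x' y) \<in> borel_measurable (borel \<Otimes>\<^sub>M borel \<Otimes>\<^sub>M borel)"
  shows "triple_mean M (\<lambda>x x' y. g x y x') = triple_mean M g"
    and "triple_mean M (\<lambda>x x' y. g x' y x) = triple_mean M g"
proof -
  interpret P: pair_sigma_finite M M ..
  have [measurable (raw)]: "(\<lambda>z. g (a z) (b z) (c z)) \<in> borel_measurable N"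
    if [measurable]: "a \<in> borel_measurable N" "b \<in> borel_measurable N" "c \<in> borel_measurable N"
    for a b c and N :: "'z measure"
    using measurable_compose[of "\<lambda>z. (a z, b z, c z)", OF _ assms] by simp
  have inner: "(\<integral>\<^sup>+x'. \<integral>\<^sup>+y. ennreal (g x y x') \<partial>M \<partial>M) = (\<integral>\<^sup>+x'. \<integral>\<^sup>+y. ennreal (g x x' y) \<partial>M \<partial>M)" for x
    by (rule P.Fubini') simp
  show "triple_mean M (\<lambda>x x' y. g x y x') = triple_mean M g"
    by (simp add: triple_mean_def inner)
  have "triple_mean M (\<lambda>x x' y. g x' y x) = (\<integral>\<^sup>+x'. \<integral>\<^sup>+x. \<integral>\<^sup>+y. ennreal (g x' y x) \<partial>M \<partial>M \<partial>M)"
    unfolding triple_mean_def by (rule P.Fubini') simp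
  then show "triple_mean M (\<lambda>x x' y. g x' y x) = triple_mean M g"
    by (simp add: triple_mean_def inner)
qed

definition abs_diff :: "real \<Rightarrow> real \<Rightarrow> real" where
  "abs_diff x y = \<bar>x - y\<bar>"

definition sq_diff :: "real \<Rightarrow> real \<Rightarrow> real" where
  "sq_diff x y = (x - y)\<^sup>2"

definition abs_sum :: "real \<Rightarrow> real \<Rightarrow> real" where
  "abs_sum x y = \<bar>x\<bar> + \<bar>y\<bar>"

lemma symmetric_kernel_abs_diff: "symmetric_kernel abs_diff" and midpoint_convex_abs_diff: "midpoint_convex abs_diff"
  and symmetric_kernel_abs_sum: "symmetric_kernel abs_sum" and midpoint_convex_abs_sum: "midpoint_convex abs_sum"
  and symmetric_kernel_sq_diff: "symmetric_kernel sq_diff"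
proof -
  show "symmetric_kernel abs_diff" "symmetric_kernel abs_sum" "symmetric_kernel sq_diff"
    by (auto simp: symmetric_kernel_def abs_diff_def abs_sum_def sq_diff_def case_prod_beta power2_commute)
  have "\<bar>(x + x') / 2 - y\<bar> \<le> (\<bar>x - y\<bar> + \<bar>x' - y\<bar>) / 2" for x x' y :: real
    by (auto simp: abs_if field_simps)
  then show "midpoint_convex abs_diff"
    by (simp add: midpoint_convex_def abs_diff_def)
  have "\<bar>(x + x') / 2\<bar> + \<bar>y\<bar> \<le> (\<bar>x\<bar> + \<bar>y\<bar> + (\<bar>x'\<bar> + \<bar>y\<bar>)) / 2" for x x' y :: real
    by (auto simp: abs_if field_simps)
  then show "midpoint_convex abs_sum"
    by (simp add: midpoint_convex_def abs_sum_def)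
qed

text \<open>
  The parallelogram identity. For the squared distance the expected defect is therefore exactly a
  quarter of the expected squared distance, whatever the law is.
\<close>

lemma defect_sq_diff: "defect sq_diff x x' y = sq_diff x x' / 4"
  by (simp add: defect_def at_midpoint_def sq_diff_def power2_eq_square field_simps)

lemma midpoint_convex_sq_diff: "midpoint_convex sq_diff"
proof -
  have "0 \<le> defect sq_diff x x' y" for x x' y
    by (simp add: defect_sq_diff) (simp add: sq_diff_def)
  then show ?thesis
    by (simp add: midpoint_convex_def defect_def at_midpoint_def)
qed

text \<open>
  For the distance the defect \<open>defect abs_diff x x' y\<close> is nonzero only if \<open>y\<close> lies strictly between
  \<open>x\<close> and \<open>x'\<close>, and then it is the smaller of the two gaps. Letting each of three points play the role
  of \<open>y\<close> once, one of them is the median, and the sum is the smaller gap.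
\<close>

lemma defect_abs_diff_sum_ge:
  fixes x x' y d :: real
  assumes "d \<le> \<bar>x - y\<bar>" "d \<le> \<bar>x - x'\<bar>" "d \<le> \<bar>x' - y\<bar>"
  shows "d \<le> defect abs_diff x x' y + defect abs_diff x y x' + defect abs_diff x' y x"
  using assms unfolding defect_def at_midpoint_def abs_diff_def
  by (auto simp: abs_if field_simps split: if_splits)

text \<open>
  Log-concavity enters only through this multiplicative four-point inequality, which is stable under
  reflection and concerns functions on the whole line.
\<close>

locale log_concave_law =
  fixes f :: "real \<Rightarrow> real"
  assumes f_measurable[measurable]: "f \<in> borel_measurable borel"
    and f_nonneg: "\<And>x. 0 \<le> f x"
    and f_mass: "(\<integral>\<^sup>+x. ennreal (f x) \<partial>lborel) = 1"
    and four_point: "\<And>a u v. 0 \<le> u \<Longrightarrow> 0 \<le> v \<Longrightarrow> f a * f (a + u + v) \<le> f (a + u) * f (a + v)"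
begin

definition law :: "real measure" where
  "law = density lborel f"

sublocale real_prob_space law
proof (intro real_prob_space.intro real_prob_space_axioms.intro prob_spaceI)
  show "emeasure law (space law) = 1"
    using f_mass by (simp add: law_def emeasure_density)
qed (simp add: law_def)

lemma nn_integral_law:
  assumes [measurable]: "g \<in> borel_measurable borel"
  shows "(\<integral>\<^sup>+x. g x \<partial>law) = (\<integral>\<^sup>+x. ennreal (f x) * g x \<partial>lborel)"
  unfolding law_def by (rule nn_integral_density) auto

text \<open>
  The part of a moment about \<open>p\<close> that comes from the right of \<open>p\<close>.
\<close>

definition side :: "real \<Rightarrow> (real \<Rightarrow> real) \<Rightarrow> ennreal" where
  "side p h = (\<integral>\<^sup>+w. ennreal (f (p + w)) * ennreal (h w) * indicator {0..} w \<partial>lborel)"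

text \<open>
  The weight \<open>w\<close> is the length of the set of decompositions \<open>w = u + v\<close> into nonnegative parts. This
  turns a single integral with weight \<open>w\<close> into a double integral over \<open>u\<close> and \<open>v\<close>, to which the
  four-point inequality applies pointwise. It is an integrated form of the fact that the hazard rate
  of a log-concave density increases.
\<close>

lemma side_hazard:
  assumes [measurable]: "h \<in> borel_measurable borel" and h: "\<And>w. 0 \<le> w \<Longrightarrow> 0 \<le> h w"
  shows "ennreal (f p) * side p (\<lambda>w. w * h w)
    \<le> (\<integral>\<^sup>+u. \<integral>\<^sup>+v. ennreal (f (p + u)) * ennreal (f (p + v)) * ennreal (h (u + v))
        * indicator {0..} u * indicator {0..} v \<partial>lborel \<partial>lborel)" (is "_ \<le> ?R")
proof -
  define G where "G w = ennreal (f p) * ennreal (f (p + w)) * ennreal (h w)" for w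
  have [measurable]: "G \<in> borel_measurable borel"
    unfolding G_def by measurable
  have "ennreal (f p) * side p (\<lambda>w. w * h w)
      = (\<integral>\<^sup>+w. ennreal (f p) * (ennreal (f (p + w)) * ennreal (w * h w) * indicator {0..} w) \<partial>lborel)"
    unfolding side_def by (subst nn_integral_cmult) auto
  also have "\<dots> = (\<integral>\<^sup>+w. \<integral>\<^sup>+u. G w * indicator {0..w} u \<partial>lborel \<partial>lborel)"
  proof (rule nn_integral_cong)
    fix w :: real
    have "(\<integral>\<^sup>+u. G w * indicator {0..w} u \<partial>lborel) = G w * (ennreal w * indicator {0..} w)"
      by (subst nn_integral_cmult_indicator) (auto split: split_indicator)
    then show "ennreal (f p) * (ennreal (f (p + w)) * ennreal (w * h w) * indicator {0..} w)
        = (\<integral>\<^sup>+u. G w * indicator {0..w} u \<partial>lborel)"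
      by (auto simp: G_def ennreal_mult h mult_ac split: split_indicator)
  qed
  also have "\<dots> = (\<integral>\<^sup>+u. \<integral>\<^sup>+w. G w * indicator {0..w} u \<partial>lborel \<partial>lborel)"
    by (rule lborel_pair.Fubini') (simp add: indicator_def)
  also have "\<dots> = (\<integral>\<^sup>+u. \<integral>\<^sup>+v. G (u + 1 * v) * indicator {0..u + 1 * v} u \<partial>lborel \<partial>lborel)"
  proof (rule nn_integral_cong)
    fix u :: real
    have "(\<lambda>w. G w * indicator {0..w} u) \<in> borel_measurable borel"
      unfolding indicator_def atLeastAtMost_iff by measurable
    from nn_integral_real_affine[OF this, of 1 u]
    show "(\<integral>\<^sup>+w. G w * indicator {0..w} u \<partial>lborel) = (\<integral>\<^sup>+v. G (u + 1 * v) * indicator {0..u + 1 * v} u \<partial>lborel)"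
      by simp
  qed
  also have "\<dots> \<le> ?R"
  proof (intro nn_integral_mono)
    fix u v :: real
    have "ennreal (f p) * ennreal (f (p + (u + v))) \<le> ennreal (f (p + u)) * ennreal (f (p + v))"
      if "0 \<le> u" "0 \<le> v"
      using four_point[OF that, of p] f_nonneg
      by (simp add: ennreal_mult[symmetric] add.assoc ennreal_leI)
    then show "G (u + 1 * v) * indicator {0..u + 1 * v} u
        \<le> ennreal (f (p + u)) * ennreal (f (p + v)) * ennreal (h (u + v)) * indicator {0..} u * indicator {0..} v"
      by (auto simp: G_def intro!: mult_right_mono split: split_indicator)
  qed
  finally show ?thesis .
qed

lemma side_product:
  assumes [measurable]: "h \<in> borel_measurable borel" "k \<in> borel_measurable borel"
  shows "(\<integral>\<^sup>+u. \<integral>\<^sup>+v. ennreal (f (p + u)) * ennreal (f (p + v)) * (ennreal (h u) * ennreal (k v))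
        * indicator {0..} u * indicator {0..} v \<partial>lborel \<partial>lborel) = side p h * side p k"
proof -
  have "(\<integral>\<^sup>+u. \<integral>\<^sup>+v. ennreal (f (p + u)) * ennreal (f (p + v)) * (ennreal (h u) * ennreal (k v))
        * indicator {0..} u * indicator {0..} v \<partial>lborel \<partial>lborel)
      = (\<integral>\<^sup>+u. (ennreal (f (p + u)) * ennreal (h u) * indicator {0..} u) * side p k \<partial>lborel)"
    unfolding side_def
    by (intro nn_integral_cong, subst nn_integral_cmult[symmetric]) (auto simp: mult_ac)
  also have "\<dots> = side p h * side p k"
    unfolding side_def[of p h] by (rule nn_integral_multc) measurable
  finally show ?thesis .
qed

lemma side_first_moment: "ennreal (f p) * side p (\<lambda>w. w) \<le> side p (\<lambda>_. 1) * side p (\<lambda>_. 1)"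
  using side_hazard[of "\<lambda>_. 1" p] side_product[of "\<lambda>_. 1" "\<lambda>_. 1" p] by simp

lemma side_second_moment:
  "ennreal (f p) * side p (\<lambda>w. w\<^sup>2) \<le> 2 * side p (\<lambda>w. w) * side p (\<lambda>_. 1)"
proof -
  define F where "F h k u v = ennreal (f (p + u)) * ennreal (f (p + v)) * (ennreal (h u) * ennreal (k v))
    * indicator {0..} u * indicator {0..} v" for h k :: "real \<Rightarrow> real" and u v
  have measurable_ident_borel: "(\<lambda>w::real. w) \<in> borel_measurable borel" by simp
  have [measurable]: "(\<lambda>(u, v). F h k u v) \<in> borel_measurable (borel \<Otimes>\<^sub>M borel)"
    if [measurable]: "h \<in> borel_measurable borel" "k \<in> borel_measurable borel" for h k
    unfolding F_def by measurable
  have "ennreal (f p) * side p (\<lambda>w. w\<^sup>2)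
    \<le> (\<integral>\<^sup>+u. \<integral>\<^sup>+v. ennreal (f (p + u)) * ennreal (f (p + v)) * ennreal (u + v)
        * indicator {0..} u * indicator {0..} v \<partial>lborel \<partial>lborel)"
    using side_hazard[of "\<lambda>w. w" p] by (simp add: power2_eq_square)
  also have "\<dots> = (\<integral>\<^sup>+u. \<integral>\<^sup>+v. F (\<lambda>w. w) (\<lambda>_. 1) u v + F (\<lambda>_. 1) (\<lambda>w. w) u v \<partial>lborel \<partial>lborel)"
    unfolding F_def by (intro nn_integral_cong) (auto simp: distrib_left distrib_right split: split_indicator)
  also have "\<dots> = (\<integral>\<^sup>+u. \<integral>\<^sup>+v. F (\<lambda>w. w) (\<lambda>_. 1) u v \<partial>lborel \<partial>lborel)
      + (\<integral>\<^sup>+u. \<integral>\<^sup>+v. F (\<lambda>_. 1) (\<lambda>w. w) u v \<partial>lborel \<partial>lborel)"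
    by (simp add: nn_integral_add)
  also have "\<dots> = side p (\<lambda>w. w) * side p (\<lambda>_. 1) + side p (\<lambda>_. 1) * side p (\<lambda>w. w)"
    unfolding F_def by (simp only: side_product borel_measurable_const measurable_ident_borel)
  also have "\<dots> = 2 * side p (\<lambda>w. w) * side p (\<lambda>_. 1)"
    by (simp add: mult_2 distrib_left distrib_right mult.commute)
  finally show ?thesis .
qed

end

lemma (in log_concave_law) log_concave_law_reflect:
  "log_concave_law (\<lambda>x. f (2 * p - x))"
proof
  show "(\<integral>\<^sup>+x. ennreal (f (2 * p - x)) \<partial>lborel) = 1"
    using f_mass by (subst (asm) nn_integral_real_affine[where c="-1" and t="2 * p"]) auto
  show "f (2 * p - a) * f (2 * p - (a + u + v)) \<le> f (2 * p - (a + u)) * f (2 * p - (a + v))"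
    if "0 \<le> u" "0 \<le> v" for a u v
    using four_point[OF that, of "2 * p - (a + u + v)"] by (simp add: algebra_simps)
qed (auto simp: f_nonneg)

context log_concave_law
begin

lemma law_integral_sides:
  assumes [measurable]: "h \<in> borel_measurable borel"
  shows "(\<integral>\<^sup>+x. ennreal (h \<bar>x - p\<bar>) \<partial>law) = side p h + log_concave_law.side (\<lambda>x. f (2 * p - x)) p h"
proof -
  interpret refl: log_concave_law "\<lambda>x. f (2 * p - x)" by (rule log_concave_law_reflect)
  have "(\<integral>\<^sup>+x. ennreal (h \<bar>x - p\<bar>) \<partial>law) = (\<integral>\<^sup>+x. ennreal (f x) * ennreal (h \<bar>x - p\<bar>) \<partial>lborel)"
    by (rule nn_integral_law) measurable
  also have "\<dots> = (\<integral>\<^sup>+w. ennreal (f (p + w)) * ennreal (h \<bar>w\<bar>) \<partial>lborel)"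
    by (subst nn_integral_real_affine[where c=1 and t=p]) auto
  also have "\<dots> = (\<integral>\<^sup>+w. ennreal (f (p + w)) * ennreal (h w) * indicator {0..} w
      + ennreal (f (p + w)) * ennreal (h (- w)) * indicator {..0} w \<partial>lborel)"
  proof (rule nn_integral_cong_AE)
    have "AE w in lborel. w \<noteq> (0::real)" by (rule AE_lborel_singleton)
    then show "AE w in lborel. ennreal (f (p + w)) * ennreal (h \<bar>w\<bar>)
      = ennreal (f (p + w)) * ennreal (h w) * indicator {0..} w
      + ennreal (f (p + w)) * ennreal (h (- w)) * indicator {..0} w"
      by eventually_elim (auto split: split_indicator)
  qed
  also have "\<dots> = side p h + (\<integral>\<^sup>+w. ennreal (f (p + w)) * ennreal (h (- w)) * indicator {..0} w \<partial>lborel)"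
    unfolding side_def by (rule nn_integral_add) auto
  also have "(\<integral>\<^sup>+w. ennreal (f (p + w)) * ennreal (h (- w)) * indicator {..0} w \<partial>lborel) = refl.side p h"
    unfolding refl.side_def
    by (subst nn_integral_real_affine[where c="-1" and t=0])
      (auto intro!: nn_integral_cong simp: indicator_def)
  finally show ?thesis .
qed

text \<open>
  The two sides of \<open>p\<close> carry masses \<open>r\<close> and \<open>l\<close> with \<open>r + l = 1\<close>, and the one-sided bounds add up to
  \<open>r\<^sup>2 + l\<^sup>2 \<le> 1\<close>. So the density cannot be large at any point of a spread-out law.
\<close>

lemma density_first_moment: "ennreal (f p) * (\<integral>\<^sup>+x. ennreal \<bar>x - p\<bar> \<partial>law) \<le> 1"
proof -
  interpret refl: log_concave_law "\<lambda>x. f (2 * p - x)" by (rule log_concave_law_reflect)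
  define r l where "r = side p (\<lambda>_. 1)" and "l = refl.side p (\<lambda>_. 1)"
  have rl: "r + l = 1"
    unfolding r_def l_def using law_integral_sides[of "\<lambda>_. 1" p] by (simp add: emeasure_space_1)
  then have "r \<le> 1" "l \<le> 1" by (metis le_iff_add add.commute)+
  have "ennreal (f p) * (\<integral>\<^sup>+x. ennreal \<bar>x - p\<bar> \<partial>law) \<le> r * r + l * l"
    using side_first_moment[of p] refl.side_first_moment[of p]
    unfolding law_integral_sides[of "\<lambda>w. w" p, simplified] r_def l_def
    by (simp add: distrib_left add_mono)
  also have "\<dots> \<le> r * 1 + l * 1"
    using \<open>r \<le> 1\<close> \<open>l \<le> 1\<close> by (intro add_mono mult_left_mono) auto
  finally show ?thesis using rl by simp
qed

lemma density_second_moment: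
  "ennreal (f p) * (\<integral>\<^sup>+x. ennreal ((x - p)\<^sup>2) \<partial>law) \<le> 2 * (\<integral>\<^sup>+x. ennreal \<bar>x - p\<bar> \<partial>law)"
proof -
  interpret refl: log_concave_law "\<lambda>x. f (2 * p - x)" by (rule log_concave_law_reflect)
  define r l where "r = side p (\<lambda>_. 1)" and "l = refl.side p (\<lambda>_. 1)"
  have rl: "r + l = 1"
    unfolding r_def l_def using law_integral_sides[of "\<lambda>_. 1" p] by (simp add: emeasure_space_1)
  then have "r \<le> 1" "l \<le> 1" by (metis le_iff_add add.commute)+
  have "ennreal (f p) * (\<integral>\<^sup>+x. ennreal ((x - p)\<^sup>2) \<partial>law)
      \<le> 2 * side p (\<lambda>w. w) * r + 2 * refl.side p (\<lambda>w. w) * l"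
    using side_second_moment[of p] refl.side_second_moment[of p] law_integral_sides[of "\<lambda>w. w\<^sup>2" p]
    unfolding r_def l_def by (simp add: distrib_left add_mono)
  also have "\<dots> \<le> 2 * side p (\<lambda>w. w) * 1 + 2 * refl.side p (\<lambda>w. w) * 1"
    using \<open>r \<le> 1\<close> \<open>l \<le> 1\<close> by (intro add_mono mult_left_mono) auto
  also have "\<dots> = 2 * (\<integral>\<^sup>+x. ennreal \<bar>x - p\<bar> \<partial>law)"
    unfolding law_integral_sides[of "\<lambda>w. w" p, simplified] by (simp add: distrib_left)
  finally show ?thesis .
qed

text \<open>
  The distance of two points is at most the sum of their distances from \<open>p\<close>.
\<close>

lemma density_abs_diff: "ennreal (f p) * pair_mean law abs_diff \<le> 2"
proof -
  let ?m = "\<integral>\<^sup>+x. ennreal \<bar>x - p\<bar> \<partial>law"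
  have "ennreal (abs_diff x y) \<le> ennreal \<bar>x - p\<bar> + ennreal \<bar>y - p\<bar>" for x y
    using ennreal_leI[of "\<bar>x - y\<bar>" "\<bar>x - p\<bar> + \<bar>y - p\<bar>"] by (simp add: abs_diff_def)
  then have "pair_mean law abs_diff \<le> (\<integral>\<^sup>+x. \<integral>\<^sup>+y. ennreal \<bar>x - p\<bar> + ennreal \<bar>y - p\<bar> \<partial>law \<partial>law)"
    unfolding pair_mean_def by (intro nn_integral_mono)
  also have "\<dots> = 2 * ?m"
    by (simp add: nn_integral_add emeasure_space_1 mult_2)
  finally have "ennreal (f p) * pair_mean law abs_diff \<le> ennreal (f p) * (2 * ?m)"
    by (rule mult_left_mono) simp
  also have "\<dots> = 2 * (ennreal (f p) * ?m)"
    by (rule mult.left_commute)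
  also have "\<dots> \<le> 2 * 1"
    by (intro mult_left_mono density_first_moment) simp
  finally show ?thesis by simp
qed

lemma density_sq_diff: "ennreal ((f p)\<^sup>2) * pair_mean law sq_diff \<le> 8"
proof -
  let ?m = "\<integral>\<^sup>+x. ennreal \<bar>x - p\<bar> \<partial>law" and ?v = "\<integral>\<^sup>+x. ennreal ((x - p)\<^sup>2) \<partial>law"
  have sq: "sq_diff x y \<le> 2 * (x - p)\<^sup>2 + 2 * (y - p)\<^sup>2" for x y
    using zero_le_power2[of "x + y - 2 * p"] by (simp add: sq_diff_def power2_eq_square algebra_simps)
  have "ennreal (sq_diff x y) \<le> 2 * ennreal ((x - p)\<^sup>2) + 2 * ennreal ((y - p)\<^sup>2)" for x y
    using ennreal_leI[OF sq[of x y]] by (simp add: ennreal_plus ennreal_mult)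
  then have "pair_mean law sq_diff
      \<le> (\<integral>\<^sup>+x. \<integral>\<^sup>+y. 2 * ennreal ((x - p)\<^sup>2) + 2 * ennreal ((y - p)\<^sup>2) \<partial>law \<partial>law)"
    unfolding pair_mean_def by (intro nn_integral_mono)
  also have "\<dots> = 4 * ?v"
    by (simp add: nn_integral_add nn_integral_cmult emeasure_space_1 flip: distrib_right)
  finally have "ennreal ((f p)\<^sup>2) * pair_mean law sq_diff \<le> ennreal ((f p)\<^sup>2) * (4 * ?v)"
    by (rule mult_left_mono) simp
  also have "\<dots> = 4 * ennreal (f p) * (ennreal (f p) * ?v)"
    by (simp add: power2_eq_square ennreal_mult f_nonneg mult_ac)
  also have "\<dots> \<le> 4 * ennreal (f p) * (2 * ?m)"
    by (intro mult_left_mono density_second_moment) simp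
  also have "\<dots> = 8 * (ennreal (f p) * ?m)"
    by (simp add: mult_ac flip: mult.assoc)
  also have "\<dots> \<le> 8 * 1"
    by (intro mult_left_mono density_first_moment) simp
  finally show ?thesis by simp
qed

definition close :: "real \<Rightarrow> real \<Rightarrow> real \<Rightarrow> real" where
  "close d x y = (if \<bar>x - y\<bar> < d then 1 else 0)"

lemma symmetric_kernel_close: "symmetric_kernel (close d)"
  by (auto simp: symmetric_kernel_def close_def case_prod_beta abs_minus_commute)

lemma pair_mean_close:
  assumes le: "\<And>x. f x \<le> m" and d: "0 \<le> d"
  shows "pair_mean law (close d) \<le> ennreal (2 * d * m)"
proof -
  note [measurable] = symmetric_kernel_measurable[OF symmetric_kernel_close]
  have m: "0 \<le> m" using f_nonneg[of 0] le[of 0] by simp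
  have inner: "(\<integral>\<^sup>+y. ennreal (close d x y) \<partial>law) \<le> ennreal (2 * d * m)" for x
  proof -
    have "(\<integral>\<^sup>+y. ennreal (close d x y) \<partial>law) = (\<integral>\<^sup>+y. ennreal (f y) * ennreal (close d x y) \<partial>lborel)"
      by (rule nn_integral_law) measurable
    also have "\<dots> \<le> (\<integral>\<^sup>+y. ennreal m * indicator {x - d .. x + d} y \<partial>lborel)"
      by (intro nn_integral_mono) (auto simp: close_def le ennreal_leI split: split_indicator)
    also have "\<dots> = ennreal (2 * d * m)"
      using d m by (subst nn_integral_cmult_indicator) (auto simp: ennreal_mult[symmetric] mult_ac)
    finally show ?thesis .
  qed
  have "pair_mean law (close d) \<le> (\<integral>\<^sup>+x. ennreal (2 * d * m) \<partial>law)"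
    unfolding pair_mean_def by (intro nn_integral_mono inner)
  then show ?thesis by (simp add: emeasure_space_1)
qed

text \<open>
  If the density is at most \<open>m\<close>, two independent points are within distance \<open>d\<close> with probability at
  most \<open>2 * d * m\<close>, and otherwise they contribute at least \<open>d\<close> to the mean distance.
\<close>

lemma abs_diff_lower_bound:
  assumes le: "\<And>x. f x \<le> m" and d: "0 \<le> d" and D: "pair_mean law abs_diff = ennreal D" "0 \<le> D"
  shows "d \<le> D + d * (2 * d * m)"
proof -
  note [measurable] = symmetric_kernel_measurable[OF symmetric_kernel_close] symmetric_kernel_measurable[OF symmetric_kernel_abs_diff]
  have m: "0 \<le> m" using f_nonneg[of 0] le[of 0] by simp
  have "ennreal d = (\<integral>\<^sup>+x. \<integral>\<^sup>+y. ennreal d \<partial>law \<partial>law)"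
    by (simp add: emeasure_space_1)
  also have "\<dots> \<le> (\<integral>\<^sup>+x. \<integral>\<^sup>+y. ennreal (abs_diff x y) + ennreal d * ennreal (close d x y) \<partial>law \<partial>law)"
    using d by (intro nn_integral_mono) (auto simp: abs_diff_def close_def intro!: ennreal_leI)
  also have "\<dots> = pair_mean law abs_diff + ennreal d * pair_mean law (close d)"
    unfolding pair_mean_def by (simp add: nn_integral_add nn_integral_cmult)
  also have "\<dots> \<le> ennreal D + ennreal d * ennreal (2 * d * m)"
    unfolding D by (intro add_mono mult_left_mono pair_mean_close le d) auto
  also have "\<dots> = ennreal (D + d * (2 * d * m))"
    using d D m by (simp add: ennreal_mult ennreal_plus)
  finally show ?thesis
    using d D m by (subst (asm) ennreal_le_iff) auto
qed

text \<open>
  A reverse Jensen inequality. By the preceding bound with \<open>m = 1 / (9 * D)\<close> and \<open>d = 9 / 4 * D\<close> the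
  density exceeds \<open>1 / (9 * D)\<close> at some point \<open>p\<close>, and the second moment about such a point is
  of order \<open>D\<^sup>2\<close>.
\<close>

lemma sq_diff_le_abs_diff:
  assumes D: "pair_mean law abs_diff = ennreal D" "0 < D"
  shows "pair_mean law sq_diff \<le> ennreal (648 * D\<^sup>2)"
proof -
  have "\<exists>p. 1 / (9 * D) < f p"
  proof (rule ccontr)
    assume "\<not> ?thesis"
    then have le: "f p \<le> 1 / (9 * D)" for p by (simp add: not_less)
    have "9 / 4 * D \<le> D + 9 / 4 * D * (2 * (9 / 4 * D) * (1 / (9 * D)))"
      by (rule abs_diff_lower_bound[OF le _ D(1)]) (use D in auto)
    then show False using D by simp
  qed
  then obtain p where p: "1 / (9 * D) < f p" ..
  have "pair_mean law sq_diff = ennreal (81 * D\<^sup>2) * (ennreal ((1 / (9 * D))\<^sup>2) * pair_mean law sq_diff)"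
    using D by (simp add: mult.assoc[symmetric] ennreal_mult[symmetric] power_divide power_mult_distrib)
  also have "\<dots> \<le> ennreal (81 * D\<^sup>2) * (ennreal ((f p)\<^sup>2) * pair_mean law sq_diff)"
    using p D by (intro mult_left_mono mult_right_mono ennreal_leI power_mono) auto
  also have "\<dots> \<le> ennreal (81 * D\<^sup>2) * 8"
    by (intro mult_left_mono density_sq_diff) simp
  also have "\<dots> = ennreal (648 * D\<^sup>2)"
    by (subst ennreal_numeral[symmetric], subst ennreal_mult[symmetric]) auto
  finally show ?thesis .
qed

text \<open>
  The density is at most \<open>2 / D\<close>, so three independent points have pairwise distances at least
  \<open>d = D / 24\<close> with probability at least one half. In that event the three defects obtained by
  permuting the points sum to at least \<open>d\<close>, and by exchangeability each of them has the same mean.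
\<close>

lemma defect_abs_diff_ge:
  assumes D: "pair_mean law abs_diff = ennreal D" "0 < D"
  shows "ennreal (D / 144) \<le> triple_mean law (defect abs_diff)"
proof (cases "triple_mean law (defect abs_diff)")
  case (real T)
  note [measurable] = symmetric_kernel_measurable[OF symmetric_kernel_close] symmetric_kernel_measurable[OF symmetric_kernel_abs_diff]
  have f_le: "f p \<le> 2 / D" for p
  proof -
    have "ennreal (f p * D) \<le> ennreal 2"
      using density_abs_diff[of p] D f_nonneg[of p] by (simp add: ennreal_mult)
    then have "f p * D \<le> 2" by (subst (asm) ennreal_le_iff) auto
    then show ?thesis using D by (simp add: field_simps)
  qed
  have three: "a + a + a = 3 * a" for a :: ennreal
  proof -
    have "(3 :: ennreal) = 1 + 1 + 1" by simp
    then show ?thesis by (simp only: distrib_right mult_1_left)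
  qed
  \<comment> \<open>Each of the three pairs is closer than this with probability at most one sixth.\<close>
  define d where "d = D / 24"
  have d: "0 < d" using D by (simp add: d_def)
  define c where "c x x' y = ennreal (close d x y) + ennreal (close d x' y) + ennreal (close d x x')" for x x' y
  define s where "s x x' y = ennreal (defect abs_diff x x' y) + ennreal (defect abs_diff x y x') + ennreal (defect abs_diff x' y x)" for x x' y
  note [measurable] = defect_measurable[OF symmetric_kernel_abs_diff]
  have [measurable (raw)]: "(\<lambda>z. c (x z) (x' z) (y z)) \<in> borel_measurable N"
      "(\<lambda>z. s (x z) (x' z) (y z)) \<in> borel_measurable N"
    if [measurable]: "x \<in> borel_measurable N" "x' \<in> borel_measurable N" "y \<in> borel_measurable N"
    for x x' y and N :: "'z measure"
    unfolding c_def s_def by measurable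
  have pointwise: "ennreal d \<le> s x x' y + ennreal d * c x x' y" for x x' y
  proof (cases "d \<le> \<bar>x - y\<bar> \<and> d \<le> \<bar>x - x'\<bar> \<and> d \<le> \<bar>x' - y\<bar>")
    case True
    then have "ennreal d \<le> s x x' y"
      using defect_abs_diff_sum_ge[of d x y x'] defect_nonneg[OF midpoint_convex_abs_diff]
      unfolding s_def by (simp add: ennreal_plus[symmetric] ennreal_leI del: ennreal_plus)
    then show ?thesis by (simp add: add_increasing2)
  next
    case False
    then have "1 \<le> c x x' y"
      by (auto simp: c_def close_def)
    then have "ennreal d * 1 \<le> ennreal d * c x x' y"
      by (rule mult_left_mono) simp
    then show ?thesis by (simp add: add_increasing)
  qed
  have "ennreal d = (\<integral>\<^sup>+x. \<integral>\<^sup>+x'. \<integral>\<^sup>+y. ennreal d \<partial>law \<partial>law \<partial>law)"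
    by (simp add: emeasure_space_1)
  also have "\<dots> \<le> (\<integral>\<^sup>+x. \<integral>\<^sup>+x'. \<integral>\<^sup>+y. s x x' y + ennreal d * c x x' y \<partial>law \<partial>law \<partial>law)"
    by (intro nn_integral_mono pointwise)
  also have "\<dots> = (\<integral>\<^sup>+x. \<integral>\<^sup>+x'. \<integral>\<^sup>+y. s x x' y \<partial>law \<partial>law \<partial>law)
      + ennreal d * (\<integral>\<^sup>+x. \<integral>\<^sup>+x'. \<integral>\<^sup>+y. c x x' y \<partial>law \<partial>law \<partial>law)"
    by (simp add: nn_integral_add nn_integral_cmult)
  also have "(\<integral>\<^sup>+x. \<integral>\<^sup>+x'. \<integral>\<^sup>+y. s x x' y \<partial>law \<partial>law \<partial>law) = 3 * ennreal T"
    using triple_mean_permute[of "defect abs_diff"] real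
    unfolding s_def by (simp add: nn_integral_add triple_mean_def three)
  also have "(\<integral>\<^sup>+x. \<integral>\<^sup>+x'. \<integral>\<^sup>+y. c x x' y \<partial>law \<partial>law \<partial>law) = 3 * pair_mean law (close d)"
    using pair_mean_triple[OF real_prob_space_axioms symmetric_kernel_close, of d]
    unfolding c_def by (simp add: nn_integral_add triple_mean_def three)
  also have "3 * ennreal T + ennreal d * (3 * pair_mean law (close d))
      \<le> 3 * ennreal T + ennreal d * (3 * ennreal (2 * d * (2 / D)))"
    using d by (intro add_mono mult_left_mono pair_mean_close f_le) auto
  also have "\<dots> = ennreal (3 * T + d * (3 * (2 * d * (2 / D))))"
  proof -
    have "3 * ennreal a = ennreal (3 * a)" if "0 \<le> a" for a
      using that by (simp add: ennreal_mult)
    then show ?thesis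
      using d D real by (simp add: ennreal_mult[symmetric] ennreal_plus[symmetric] del: ennreal_plus)
  qed
  finally have "d \<le> 3 * T + d * (3 * (2 * d * (2 / D)))"
    using d D real by (subst (asm) ennreal_le_iff) auto
  then have "D / 144 \<le> T"
    using D by (simp add: d_def field_simps)
  then show ?thesis using real by (simp add: ennreal_leI)
qed simp

end

section \<open>From the density equation to its weak form\<close>

text \<open>
  The strong form of the equation, for densities on the whole line. The function \<open>G\<close> is the gain term
  as a real number; its integral representation is required only at positive times, where the equation
  holds.
\<close>

locale averaging_densities =
  fixes F G :: "real \<Rightarrow> real \<Rightarrow> real"
  assumes F_measurable: "F t \<in> borel_measurable borel"
    and F_nonneg: "0 \<le> F t x"
    and F_mass: "(\<integral>\<^sup>+x. ennreal (F t x) \<partial>lborel) = 1"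
    and F_continuous: "continuous_on UNIV (\<lambda>t. F t x)"
    and F_derivative: "0 < t \<Longrightarrow> ((\<lambda>s. F s x) has_real_derivative G t x - F t x) (at t)"
    and G_nonneg: "0 \<le> G t x"
    and G_eq: "0 < t \<Longrightarrow> ennreal (G t x) = 2 * (\<integral>\<^sup>+y. ennreal (F t y) * ennreal (F t (2 * x - y)) \<partial>lborel)"
begin

definition law :: "real \<Rightarrow> real measure" where
  "law t = density lborel (F t)"

text \<open>
  The gain term with values in \<open>[0, \<infinity>]\<close>, which makes sense at all times and is jointly measurable by
  construction.
\<close>

definition gain :: "real \<Rightarrow> real \<Rightarrow> ennreal" where
  "gain t x = 2 * (\<integral>\<^sup>+y. ennreal (F t y) * ennreal (F t (2 * x - y)) \<partial>lborel)"

text \<open>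
  A function that is measurable in space and continuous in time is the limit of functions that are
  piecewise constant in time.
\<close>

lemma F_joint_measurable: "(\<lambda>(s, x). F s x) \<in> borel_measurable (borel \<Otimes>\<^sub>M borel)"
proof (rule borel_measurable_LIMSEQ_real)
  define q where "q n s = of_int \<lfloor>real (Suc n) * s\<rfloor> / real (Suc n)" for n and s :: real
  fix z :: "real \<times> real"
  obtain s x where z: "z = (s, x)" by (cases z)
  have "(\<lambda>n. q n s) \<longlonglongrightarrow> s"
  proof (rule tendsto_sandwich)
    show "(\<lambda>n. s - inverse (real (Suc n))) \<longlonglongrightarrow> s"
      using tendsto_diff[OF tendsto_const LIMSEQ_inverse_real_of_nat] by simp
    show "\<forall>\<^sub>F n in sequentially. s - inverse (real (Suc n)) \<le> q n s"
    proof (intro always_eventually allI)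
      fix n
      have "(real (Suc n) * s - 1) / real (Suc n) \<le> q n s"
        unfolding q_def by (intro divide_right_mono) linarith+
      then show "s - inverse (real (Suc n)) \<le> q n s"
        by (simp add: diff_divide_distrib inverse_eq_divide)
    qed
    show "\<forall>\<^sub>F n in sequentially. q n s \<le> s"
      unfolding q_def by (intro always_eventually allI) (simp add: divide_le_eq mult.commute)
  qed auto
  then have "(\<lambda>n. F (q n s) x) \<longlonglongrightarrow> F s x"
    by (rule continuous_on_tendsto_compose[OF F_continuous]) auto
  then show "(\<lambda>n. case z of (s, x) \<Rightarrow> F (q n s) x) \<longlonglongrightarrow> (case z of (s, x) \<Rightarrow> F s x)"
    by (simp add: z)
next
  fix n
  note [measurable] = F_measurable
  have "(\<lambda>z. F (of_int \<lfloor>real (Suc n) * fst z\<rfloor> / real (Suc n)) (snd z))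
      \<in> borel_measurable (borel \<Otimes>\<^sub>M borel :: (real \<times> real) measure)"
    by (rule measurable_compose_countable[where f="\<lambda>i z. F (of_int i / real (Suc n)) (snd z)"]) measurable
  then show "(\<lambda>(s, x). F (of_int \<lfloor>real (Suc n) * s\<rfloor> / real (Suc n)) x) \<in> borel_measurable (borel \<Otimes>\<^sub>M borel)"
    by (simp add: case_prod_beta)
qed

lemma F_measurable2[measurable (raw)]:
  assumes [measurable]: "f \<in> borel_measurable N" "g \<in> borel_measurable N"
  shows "(\<lambda>z. F (f z) (g z)) \<in> borel_measurable N"
  using measurable_compose[of "\<lambda>z. (f z, g z)", OF _ F_joint_measurable] by simp

lemma gain_measurable2[measurable (raw)]:
  assumes [measurable]: "f \<in> borel_measurable N" "g \<in> borel_measurable N"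
  shows "(\<lambda>z. gain (f z) (g z)) \<in> borel_measurable N"
proof -
  have "(\<lambda>z. gain (fst z) (snd z)) \<in> borel_measurable (borel \<Otimes>\<^sub>M borel)"
    unfolding gain_def by measurable
  from measurable_compose[of "\<lambda>z. (f z, g z)", OF _ this] show ?thesis by simp
qed

lemma real_prob_space_law: "real_prob_space (law t)"
proof (intro real_prob_space.intro real_prob_space_axioms.intro prob_spaceI)
  show "emeasure (law t) (space (law t)) = 1"
    using F_mass by (simp add: law_def emeasure_density)
qed (simp add: law_def)

lemma nn_integral_law:
  assumes [measurable]: "g \<in> borel_measurable borel"
  shows "(\<integral>\<^sup>+x. g x \<partial>law t) = (\<integral>\<^sup>+x. ennreal (F t x) * g x \<partial>lborel)"
  unfolding law_def by (rule nn_integral_density) auto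

lemma pair_mean_law:
  assumes "symmetric_kernel \<Phi>"
  shows "pair_mean (law t) \<Phi>
    = (\<integral>\<^sup>+x. \<integral>\<^sup>+y. ennreal (F t x) * ennreal (F t y) * ennreal (\<Phi> x y) \<partial>lborel \<partial>lborel)"
proof -
  note [measurable] = symmetric_kernel_measurable[OF assms]
  have "pair_mean (law t) \<Phi> = (\<integral>\<^sup>+x. (\<integral>\<^sup>+y. ennreal (F t y) * ennreal (\<Phi> x y) \<partial>lborel) \<partial>law t)"
    unfolding pair_mean_def by (intro nn_integral_cong nn_integral_law) measurable
  also have "\<dots> = (\<integral>\<^sup>+x. ennreal (F t x) * (\<integral>\<^sup>+y. ennreal (F t y) * ennreal (\<Phi> x y) \<partial>lborel) \<partial>lborel)"
    by (rule nn_integral_law) measurable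
  also have "\<dots> = (\<integral>\<^sup>+x. \<integral>\<^sup>+y. ennreal (F t x) * ennreal (F t y) * ennreal (\<Phi> x y) \<partial>lborel \<partial>lborel)"
    by (intro nn_integral_cong, subst nn_integral_cmult[symmetric]) (auto simp: mult.assoc)
  finally show ?thesis .
qed

text \<open>
  The substitution \<open>x = (z + w) / 2\<close>, whose Jacobian cancels the factor \<open>2\<close> of the gain term, shows that
  the gain term is the density of the midpoint.
\<close>

lemma gain_integral:
  assumes [measurable]: "\<psi> \<in> borel_measurable borel"
  shows "(\<integral>\<^sup>+x. gain t x * \<psi> x \<partial>lborel) = (\<integral>\<^sup>+z. \<integral>\<^sup>+w. \<psi> ((z + w) / 2) \<partial>law t \<partial>law t)"
proof -
  have "(\<integral>\<^sup>+x. gain t x * \<psi> x \<partial>lborel)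
      = (\<integral>\<^sup>+x. \<integral>\<^sup>+z. 2 * ennreal (F t z) * ennreal (F t (2 * x - z)) * \<psi> x \<partial>lborel \<partial>lborel)"
    unfolding gain_def
    by (intro nn_integral_cong, subst nn_integral_cmult[symmetric], simp, subst nn_integral_multc[symmetric])
      (auto simp: mult.assoc)
  also have "\<dots> = (\<integral>\<^sup>+z. \<integral>\<^sup>+x. 2 * ennreal (F t z) * ennreal (F t (2 * x - z)) * \<psi> x \<partial>lborel \<partial>lborel)"
    by (rule lborel_pair.Fubini') measurable
  also have "\<dots> = (\<integral>\<^sup>+z. ennreal (F t z) * (\<integral>\<^sup>+w. \<psi> ((z + w) / 2) \<partial>law t) \<partial>lborel)"
  proof (rule nn_integral_cong)
    fix z :: real
    have half: "ennreal (1 / 2) * (2 * a) = a" for a :: ennreal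
    proof -
      have "ennreal (1 / 2) * 2 = 1"
        by (subst ennreal_numeral[symmetric], subst ennreal_mult[symmetric]) auto
      then show ?thesis by (simp add: mult.assoc[symmetric])
    qed
    have "(\<integral>\<^sup>+x. 2 * ennreal (F t z) * ennreal (F t (2 * x - z)) * \<psi> x \<partial>lborel)
        = ennreal \<bar>1 / 2\<bar> * (\<integral>\<^sup>+w. 2 * ennreal (F t z) * ennreal (F t (2 * (z / 2 + 1 / 2 * w) - z)) * \<psi> (z / 2 + 1 / 2 * w) \<partial>lborel)"
      by (rule nn_integral_real_affine) auto
    also have "\<dots> = (\<integral>\<^sup>+w. ennreal (1 / 2) * (2 * (ennreal (F t z) * (ennreal (F t w) * \<psi> ((z + w) / 2)))) \<partial>lborel)"
      by (subst nn_integral_cmult[symmetric]) (auto simp: mult.assoc add_divide_distrib)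
    also have "\<dots> = ennreal (F t z) * (\<integral>\<^sup>+w. ennreal (F t w) * \<psi> ((z + w) / 2) \<partial>lborel)"
      unfolding half by (rule nn_integral_cmult) measurable
    also have "(\<integral>\<^sup>+w. ennreal (F t w) * \<psi> ((z + w) / 2) \<partial>lborel) = (\<integral>\<^sup>+w. \<psi> ((z + w) / 2) \<partial>law t)"
      by (rule nn_integral_law[symmetric]) measurable
    finally show "(\<integral>\<^sup>+x. 2 * ennreal (F t z) * ennreal (F t (2 * x - z)) * \<psi> x \<partial>lborel)
        = ennreal (F t z) * (\<integral>\<^sup>+w. \<psi> ((z + w) / 2) \<partial>law t)" .
  qed
  also have "\<dots> = (\<integral>\<^sup>+z. \<integral>\<^sup>+w. \<psi> ((z + w) / 2) \<partial>law t \<partial>law t)"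
  proof (rule nn_integral_law[symmetric])
    interpret real_prob_space "law t" by (rule real_prob_space_law)
    show "(\<lambda>z. \<integral>\<^sup>+w. \<psi> ((z + w) / 2) \<partial>law t) \<in> borel_measurable borel" by measurable
  qed
  finally show ?thesis .
qed

text \<open>
  The factor \<open>exp (2 * t)\<close> absorbs the two loss terms. What is left of the derivative is nonnegative,
  so the fundamental theorem of calculus yields an identity between Lebesgue integrals without any
  integrability assumption in time, and the later exchanges of integrals are cases of Tonelli's theorem.
\<close>

lemma product_evolution:
  assumes t: "0 \<le> t"
  shows "ennreal (exp (2 * t)) * (ennreal (F t x) * ennreal (F t y)) = ennreal (F 0 x) * ennreal (F 0 y)
    + (\<integral>\<^sup>+s. ennreal (exp (2 * s)) * (gain s x * ennreal (F s y) + ennreal (F s x) * gain s y) * indicator {0..t} s \<partial>lborel)"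
proof -
  define P where "P s = exp (2 * s) * (F s x * F s y)" for s
  define p where "p s = exp (2 * s) * (G s x * F s y + F s x * G s y)" for s
  have p_nonneg: "0 \<le> p s" for s
    by (simp add: p_def F_nonneg G_nonneg)
  have p_int: "(p has_integral P t - P 0) {0..t}"
  proof (rule fundamental_theorem_of_calculus_interior[OF t])
    show "continuous_on {0..t} P"
      unfolding P_def by (intro continuous_intros continuous_on_subset[OF F_continuous]) auto
    fix s assume "s \<in> {0<..<t}"
    then have "0 < s" by simp
    show "(P has_vector_derivative p s) (at s)"
      unfolding has_real_derivative_iff_has_vector_derivative[symmetric] P_def p_def
      by (rule derivative_eq_intros F_derivative \<open>0 < s\<close> refl)+ (simp add: algebra_simps)
  qed
  have "0 \<le> P t - P 0"
    using has_integral_nonneg[OF p_int] p_nonneg by simp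
  have "(\<integral>\<^sup>+s. ennreal (exp (2 * s)) * (gain s x * ennreal (F s y) + ennreal (F s x) * gain s y) * indicator {0..t} s \<partial>lborel)
      = (\<integral>\<^sup>+s. ennreal (p s) * indicator {0..t} s \<partial>lborel)"
  proof (rule nn_integral_cong_AE)
    have "AE s in lborel. s \<noteq> (0::real)" by (rule AE_lborel_singleton)
    then show "AE s in lborel. ennreal (exp (2 * s)) * (gain s x * ennreal (F s y) + ennreal (F s x) * gain s y) * indicator {0..t} s
        = ennreal (p s) * indicator {0..t} s"
    proof eventually_elim
      case (elim s)
      show ?case
      proof (cases "0 < s")
        case True
        then show ?thesis
          unfolding gain_def G_eq[OF True, symmetric] p_def
          by (simp add: ennreal_mult ennreal_plus F_nonneg G_nonneg)
      qed (use elim in auto)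
    qed
  qed
  also have "\<dots> = ennreal (P t - P 0)"
    by (rule nn_integral_has_integral_lebesgue'[OF p_nonneg p_int])
  finally have *: "(\<integral>\<^sup>+s. ennreal (exp (2 * s)) * (gain s x * ennreal (F s y) + ennreal (F s x) * gain s y) * indicator {0..t} s \<partial>lborel)
      = ennreal (P t - P 0)" .
  have "0 \<le> P 0" by (simp add: P_def F_nonneg)
  then have "ennreal (P t) = ennreal (P 0) + ennreal (P t - P 0)"
    using \<open>0 \<le> P t - P 0\<close> by (simp add: ennreal_plus[symmetric] del: ennreal_plus)
  then show ?thesis
    unfolding * by (simp add: P_def ennreal_mult F_nonneg)
qed

lemma triple_mean_at_midpoint_eq:
  assumes "symmetric_kernel \<Phi>"
  shows "triple_mean (law s) (at_midpoint \<Phi>)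
    = (\<integral>\<^sup>+x. \<integral>\<^sup>+y. gain s x * ennreal (F s y) * ennreal (\<Phi> x y) \<partial>lborel \<partial>lborel)"
proof -
  note [measurable] = symmetric_kernel_measurable[OF assms]
  define \<psi> where "\<psi> x = (\<integral>\<^sup>+y. ennreal (\<Phi> x y) \<partial>law s)" for x
  have \<psi>: "\<psi> x = (\<integral>\<^sup>+y. ennreal (F s y) * ennreal (\<Phi> x y) \<partial>lborel)" for x
    unfolding \<psi>_def by (rule nn_integral_law) measurable
  have "\<psi> \<in> borel_measurable borel"
    unfolding \<psi> by measurable
  then have "triple_mean (law s) (at_midpoint \<Phi>) = (\<integral>\<^sup>+x. gain s x * \<psi> x \<partial>lborel)"
    unfolding triple_mean_def at_midpoint_def \<psi>_def[symmetric] by (rule gain_integral[symmetric])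
  also have "\<dots> = (\<integral>\<^sup>+x. \<integral>\<^sup>+y. gain s x * ennreal (F s y) * ennreal (\<Phi> x y) \<partial>lborel \<partial>lborel)"
    unfolding \<psi> by (intro nn_integral_cong, subst nn_integral_cmult[symmetric]) (auto simp: mult.assoc)
  finally show ?thesis .
qed

lemma pair_integral_gain:
  assumes "symmetric_kernel \<Phi>"
  shows "(\<integral>\<^sup>+x. \<integral>\<^sup>+y. (gain s x * ennreal (F s y) + ennreal (F s x) * gain s y) * ennreal (\<Phi> x y) \<partial>lborel \<partial>lborel)
    = 2 * triple_mean (law s) (at_midpoint \<Phi>)"
proof -
  note [measurable] = symmetric_kernel_measurable[OF assms]
  have "(\<integral>\<^sup>+x. \<integral>\<^sup>+y. ennreal (F s x) * gain s y * ennreal (\<Phi> x y) \<partial>lborel \<partial>lborel)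
      = (\<integral>\<^sup>+y. \<integral>\<^sup>+x. ennreal (F s x) * gain s y * ennreal (\<Phi> x y) \<partial>lborel \<partial>lborel)"
    by (rule lborel_pair.Fubini') measurable
  also have "\<dots> = (\<integral>\<^sup>+x. \<integral>\<^sup>+y. gain s x * ennreal (F s y) * ennreal (\<Phi> x y) \<partial>lborel \<partial>lborel)"
    using assms by (intro nn_integral_cong) (simp add: symmetric_kernel_def mult.commute)
  finally have "(\<integral>\<^sup>+x. \<integral>\<^sup>+y. ennreal (F s x) * gain s y * ennreal (\<Phi> x y) \<partial>lborel \<partial>lborel)
      = triple_mean (law s) (at_midpoint \<Phi>)"
    by (simp add: triple_mean_at_midpoint_eq[OF assms])
  then show ?thesis
    by (simp add: distrib_right nn_integral_add mult_2 triple_mean_at_midpoint_eq[OF assms])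
qed

sublocale midpoint_flow law
proof (intro midpoint_flow.intro real_prob_space_law)
  fix \<Phi> :: "real \<Rightarrow> real \<Rightarrow> real" assume \<Phi>: "symmetric_kernel \<Phi>"
  note [measurable] = symmetric_kernel_measurable[OF \<Phi>]
  show "(\<lambda>t. pair_mean (law t) \<Phi>) \<in> borel_measurable borel"
    unfolding pair_mean_law[OF \<Phi>] by measurable
  fix t :: real assume t: "0 \<le> t"
  define k where "k s x y = ennreal (exp (2 * s)) * (gain s x * ennreal (F s y) + ennreal (F s x) * gain s y) * indicator {0..t} s" for s x y
  have [measurable (raw)]: "(\<lambda>z. k (a z) (b z) (c z)) \<in> borel_measurable N"
    if [measurable]: "a \<in> borel_measurable N" "b \<in> borel_measurable N" "c \<in> borel_measurable N"
    for a b c and N :: "'z measure"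
    unfolding k_def by measurable
  have "ennreal (exp (2 * t)) * pair_mean (law t) \<Phi>
      = (\<integral>\<^sup>+x. \<integral>\<^sup>+y. ennreal (exp (2 * t)) * (ennreal (F t x) * ennreal (F t y)) * ennreal (\<Phi> x y) \<partial>lborel \<partial>lborel)"
    unfolding pair_mean_law[OF \<Phi>] by (simp add: nn_integral_cmult mult.assoc)
  also have "\<dots> = (\<integral>\<^sup>+x. \<integral>\<^sup>+y. ennreal (F 0 x) * ennreal (F 0 y) * ennreal (\<Phi> x y)
      + (\<integral>\<^sup>+s. k s x y * ennreal (\<Phi> x y) \<partial>lborel) \<partial>lborel \<partial>lborel)"
    unfolding product_evolution[OF t] k_def[symmetric] by (simp add: distrib_right nn_integral_multc)
  also have "\<dots> = pair_mean (law 0) \<Phi>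
      + (\<integral>\<^sup>+x. \<integral>\<^sup>+y. \<integral>\<^sup>+s. k s x y * ennreal (\<Phi> x y) \<partial>lborel \<partial>lborel \<partial>lborel)"
    unfolding pair_mean_law[OF \<Phi>] by (simp add: nn_integral_add)
  also have "(\<integral>\<^sup>+x. \<integral>\<^sup>+y. \<integral>\<^sup>+s. k s x y * ennreal (\<Phi> x y) \<partial>lborel \<partial>lborel \<partial>lborel)
      = (\<integral>\<^sup>+x. \<integral>\<^sup>+s. \<integral>\<^sup>+y. k s x y * ennreal (\<Phi> x y) \<partial>lborel \<partial>lborel \<partial>lborel)"
    by (intro nn_integral_cong lborel_pair.Fubini') measurable
  also have "\<dots> = (\<integral>\<^sup>+s. \<integral>\<^sup>+x. \<integral>\<^sup>+y. k s x y * ennreal (\<Phi> x y) \<partial>lborel \<partial>lborel \<partial>lborel)"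
    by (rule lborel_pair.Fubini') measurable
  also have "\<dots> = (\<integral>\<^sup>+s. 2 * (ennreal (exp (2 * s)) * triple_mean (law s) (at_midpoint \<Phi>) * indicator {0..t} s) \<partial>lborel)"
  proof (rule nn_integral_cong)
    fix s :: real
    have "(\<integral>\<^sup>+x. \<integral>\<^sup>+y. k s x y * ennreal (\<Phi> x y) \<partial>lborel \<partial>lborel)
        = (\<integral>\<^sup>+x. \<integral>\<^sup>+y. ennreal (exp (2 * s)) * indicator {0..t} s *
            ((gain s x * ennreal (F s y) + ennreal (F s x) * gain s y) * ennreal (\<Phi> x y)) \<partial>lborel \<partial>lborel)"
      by (intro nn_integral_cong) (simp add: k_def mult_ac)
    also have "\<dots> = ennreal (exp (2 * s)) * indicator {0..t} s * (2 * triple_mean (law s) (at_midpoint \<Phi>))"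
      unfolding pair_integral_gain[OF \<Phi>, symmetric] by (simp add: nn_integral_cmult)
    finally show "(\<integral>\<^sup>+x. \<integral>\<^sup>+y. k s x y * ennreal (\<Phi> x y) \<partial>lborel \<partial>lborel)
        = 2 * (ennreal (exp (2 * s)) * triple_mean (law s) (at_midpoint \<Phi>) * indicator {0..t} s)"
      by (simp add: mult_ac)
  qed
  also have "\<dots> = 2 * (\<integral>\<^sup>+s. ennreal (exp (2 * s)) * triple_mean (law s) (at_midpoint \<Phi>) * indicator {0..t} s \<partial>lborel)"
    unfolding triple_mean_at_midpoint_eq[OF \<Phi>] by (rule nn_integral_cmult) measurable
  finally show "ennreal (exp (2 * t)) * pair_mean (law t) \<Phi> = pair_mean (law 0) \<Phi> +
        2 * (\<integral>\<^sup>+s. ennreal (exp (2 * s)) * triple_mean (law s) (at_midpoint \<Phi>) * indicator {0..t} s \<partial>lborel)" .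
qed

text \<open>
  The loss term removes mass at rate one, and the gain term only adds to it.
\<close>

lemma F_lower_bound:
  assumes "0 \<le> t"
  shows "exp (- t) * F 0 x \<le> F t x"
proof -
  have "exp 0 * F 0 x \<le> exp t * F t x"
  proof (rule DERIV_nonneg_imp_increasing_open[OF assms])
    show "continuous_on {0..t} (\<lambda>s. exp s * F s x)"
      by (intro continuous_intros continuous_on_subset[OF F_continuous]) auto
    fix s :: real assume "0 < s"
    have "((\<lambda>s. exp s * F s x) has_real_derivative exp s * G s x) (at s)"
      by (rule derivative_eq_intros F_derivative \<open>0 < s\<close> refl)+ (simp add: algebra_simps)
    then show "\<exists>y. ((\<lambda>s. exp s * F s x) has_real_derivative y) (at s) \<and> 0 \<le> y"
      using G_nonneg by (intro exI[of _ "exp s * G s x"]) simp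
  qed
  then show ?thesis by (simp add: exp_minus field_simps)
qed

lemma nn_integral_law_lower_bound:
  assumes [measurable]: "g \<in> borel_measurable borel" and t: "0 \<le> t"
  shows "ennreal (exp (- t)) * (\<integral>\<^sup>+x. g x \<partial>law 0) \<le> (\<integral>\<^sup>+x. g x \<partial>law t)"
proof -
  have "ennreal (exp (- t)) * (\<integral>\<^sup>+x. g x \<partial>law 0) = (\<integral>\<^sup>+x. ennreal (exp (- t)) * (ennreal (F 0 x) * g x) \<partial>lborel)"
    unfolding nn_integral_law[OF assms(1)] by (simp add: nn_integral_cmult)
  also have "\<dots> \<le> (\<integral>\<^sup>+x. ennreal (F t x) * g x \<partial>lborel)"
    using F_lower_bound[OF t]
    by (intro nn_integral_mono) (simp add: mult.assoc[symmetric] ennreal_mult'[symmetric] ennreal_leI mult_right_mono)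
  finally show ?thesis unfolding nn_integral_law[OF assms(1)] .
qed

text \<open>
  The law at time \<open>t\<close> is in general not log-concave. It does contain the fraction \<open>exp (- t)\<close> of the
  log-concave initial law, hence the fraction \<open>exp (- 3 * t)\<close> of the law of three independent initial
  points.
\<close>

lemma triple_mean_defect_lower_bound:
  assumes "symmetric_kernel \<Phi>" and t: "0 \<le> t"
  shows "ennreal (exp (- 3 * t)) * triple_mean (law 0) (defect \<Phi>) \<le> triple_mean (law t) (defect \<Phi>)"
proof -
  note [measurable] = defect_measurable[OF assms(1)]
  interpret L: real_prob_space "law s" for s by (rule real_prob_space_law)
  let ?c = "ennreal (exp (- t))"
  have "exp (- 3 * t) = exp (- t) * (exp (- t) * exp (- t))"
    by (simp add: exp_add[symmetric])
  then have "ennreal (exp (- 3 * t)) * triple_mean (law 0) (defect \<Phi>)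
      = ?c * (?c * (?c * triple_mean (law 0) (defect \<Phi>)))"
    by (simp add: ennreal_mult mult.assoc)
  also have "\<dots> = ?c * (\<integral>\<^sup>+x. ?c * (\<integral>\<^sup>+x'. ?c * (\<integral>\<^sup>+y. ennreal (defect \<Phi> x x' y) \<partial>law 0) \<partial>law 0) \<partial>law 0)"
    unfolding triple_mean_def by (simp add: nn_integral_cmult)
  also have "\<dots> \<le> ?c * (\<integral>\<^sup>+x. ?c * (\<integral>\<^sup>+x'. \<integral>\<^sup>+y. ennreal (defect \<Phi> x x' y) \<partial>law t \<partial>law 0) \<partial>law 0)"
    by (intro mult_left_mono nn_integral_mono nn_integral_law_lower_bound t) auto
  also have "\<dots> \<le> ?c * (\<integral>\<^sup>+x. \<integral>\<^sup>+x'. \<integral>\<^sup>+y. ennreal (defect \<Phi> x x' y) \<partial>law t \<partial>law t \<partial>law 0)"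
    by (intro mult_left_mono nn_integral_mono nn_integral_law_lower_bound t) auto
  also have "\<dots> \<le> triple_mean (law t) (defect \<Phi>)"
    unfolding triple_mean_def by (intro nn_integral_law_lower_bound t) measurable
  finally show ?thesis .
qed

end

section \<open>Classical solutions on the half-line\<close>

definition zero_extend :: "(real \<Rightarrow> real) \<Rightarrow> real \<Rightarrow> real" where
  "zero_extend f x = (if 0 \<le> x then f x else 0)"

lemma zero_extend_eq_indicator: "zero_extend f x = indicator {0..} x *\<^sub>R f x"
  by (simp add: zero_extend_def)

lemma prob_density_zero_extend:
  assumes "prob_density f"
  shows "zero_extend f \<in> borel_measurable borel" and "0 \<le> zero_extend f x"
    and "(\<integral>\<^sup>+x. ennreal (zero_extend f x) \<partial>lborel) = 1"
proof -
  have int: "integrable lborel (zero_extend f)" and eq: "integral\<^sup>L lborel (zero_extend f) = 1"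
    using assms unfolding prob_density_def set_integrable_def set_lebesgue_integral_def
    by (simp_all add: zero_extend_eq_indicator[abs_def])
  show nonneg: "0 \<le> zero_extend f x" for x
    using assms by (simp add: prob_density_def zero_extend_def)
  show "zero_extend f \<in> borel_measurable borel"
    using borel_measurable_integrable[OF int] by simp
  show "(\<integral>\<^sup>+x. ennreal (zero_extend f x) \<partial>lborel) = 1"
    using nn_integral_eq_integral[OF int] nonneg eq by simp
qed

text \<open>
  The points \<open>a + u\<close> and \<open>a + v\<close> are convex combinations of \<open>a\<close> and \<open>a + u + v\<close> with exchanged weights, so
  the exponents in the product of the two log-concavity inequalities add up to one.
\<close>

lemma log_concave_four_point:
  assumes "log_concave f" "0 \<le> u" "0 \<le> v"
  shows "zero_extend f a * zero_extend f (a + u + v) \<le> zero_extend f (a + u) * zero_extend f (a + v)"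
proof (cases "0 \<le> a \<and> 0 < u \<and> 0 < v")
  case True
  define b \<theta> where "b = a + u + v" and "\<theta> = u / (u + v)"
  have f: "\<And>x. 0 \<le> x \<Longrightarrow> 0 \<le> f x"
    and lc: "\<And>x y \<theta>. 0 \<le> x \<Longrightarrow> 0 \<le> y \<Longrightarrow> 0 < \<theta> \<Longrightarrow> \<theta> < 1 \<Longrightarrow>
        f x powr (1 - \<theta>) * f y powr \<theta> \<le> f ((1 - \<theta>) * x + \<theta> * y)"
    using assms(1) by (auto simp: log_concave_def)
  have nonneg: "0 \<le> a" "0 \<le> b" and \<theta>: "0 < \<theta>" "\<theta> < 1"
    using True by (auto simp: b_def \<theta>_def)
  have "\<theta> * (u + v) = u" using True by (simp add: \<theta>_def)
  then have points: "(1 - \<theta>) * a + \<theta> * b = a + u" "(1 - (1 - \<theta>)) * a + (1 - \<theta>) * b = a + v"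
    by (simp_all add: b_def algebra_simps)
  have "f a * f b = (f a powr (1 - \<theta>) * f b powr \<theta>) * (f a powr (1 - (1 - \<theta>)) * f b powr (1 - \<theta>))"
  proof -
    have split: "y powr (1 - \<theta>) * y powr \<theta> = y" if "0 \<le> y" for y
      using that powr_add[of y "1 - \<theta>" \<theta>] by simp
    have "(f a powr (1 - \<theta>) * f b powr \<theta>) * (f a powr (1 - (1 - \<theta>)) * f b powr (1 - \<theta>))
        = (f a powr (1 - \<theta>) * f a powr \<theta>) * (f b powr (1 - \<theta>) * f b powr \<theta>)"
      by (simp add: mult_ac)
    then show ?thesis
      by (simp only: split f nonneg)
  qed
  also have "\<dots> \<le> f (a + u) * f (a + v)"
    using lc[OF nonneg \<theta>] lc[OF nonneg, of "1 - \<theta>"] \<theta> True f unfolding points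
    by (intro mult_mono) auto
  finally show ?thesis
    using True by (simp add: zero_extend_def b_def)
next
  case False
  have "0 \<le> zero_extend f x" for x
    using assms(1) by (simp add: log_concave_def zero_extend_def)
  then consider "a < 0" | "u = 0" | "v = 0" using False assms(2,3) by linarith
  then show ?thesis
    using \<open>\<And>x. 0 \<le> zero_extend f x\<close> by cases (auto simp: zero_extend_def[of f a] mult.commute)
qed

lemma log_concave_law_zero_extend:
  assumes "prob_density f" "log_concave f"
  shows "log_concave_law (zero_extend f)"
  using prob_density_zero_extend[OF assms(1)] log_concave_four_point[OF assms(2)]
  by (intro log_concave_law.intro) auto

text \<open>
  Freezing the solution at its initial value for negative times turns the attainment of the initial
  value into continuity on the whole time axis.
\<close>

lemma averaging_densities_of_classical_solution:
  assumes prob: "\<And>t. 0 \<le> t \<Longrightarrow> prob_density (\<rho> t)" and sol: "classical_solution \<rho>"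
  shows "averaging_densities (\<lambda>t. zero_extend (\<rho> (max 0 t)))
    (\<lambda>t x. if 0 < t \<and> 0 \<le> x then 2 * (LBINT y:{0..2 * x}. \<rho> t y * \<rho> t (2 * x - y)) else 0)"
    (is "averaging_densities ?F ?G")
proof
  fix t x :: real
  note dens = prob_density_zero_extend[OF prob]
  show "?F t \<in> borel_measurable borel" "0 \<le> ?F t x" "(\<integral>\<^sup>+x. ennreal (?F t x) \<partial>lborel) = 1"
    using dens[of "max 0 t"] by auto
  have nonneg: "0 \<le> \<rho> t x" if "0 \<le> t" "0 \<le> x" for t x
    using prob[OF that(1)] that(2) by (simp add: prob_density_def)
  have deriv: "((\<lambda>s. \<rho> s x) has_real_derivative
        (2 * (LBINT y:{0..2 * x}. \<rho> t y * \<rho> t (2 * x - y)) - \<rho> t x)) (at t)" if "0 < t" "0 \<le> x" for t x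
    using sol that by (simp add: classical_solution_def)
  show "continuous_on UNIV (\<lambda>t. ?F t x)"
  proof (cases "0 \<le> x")
    case True
    have "continuous_on {0..} (\<lambda>t. \<rho> t x)"
      unfolding continuous_on_eq_continuous_within
    proof
      fix t :: real assume "t \<in> {0..}"
      then consider "t = 0" | "0 < t" by force
      then show "continuous (at t within {0..}) (\<lambda>t. \<rho> t x)"
      proof cases
        case 1
        then show ?thesis
          using sol True by (simp add: continuous_within classical_solution_def at_within_Ici_at_right)
      next
        case 2
        then show ?thesis
          using DERIV_isCont[OF deriv[OF _ True]] continuous_at_imp_continuous_at_within by blast
      qed
    qed
    then have "continuous_on UNIV (\<lambda>t. \<rho> (max 0 t) x)"
      by (rule continuous_on_compose2) (auto intro!: continuous_intros)
    then show ?thesis using True by (simp add: zero_extend_def)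
  qed (simp add: zero_extend_def)
  show "0 \<le> ?G t x"
    by (auto simp: set_lebesgue_integral_def nonneg intro!: integral_nonneg_AE split: split_indicator)
  assume t: "0 < t"
  show "((\<lambda>s. ?F s x) has_real_derivative ?G t x - ?F t x) (at t)"
  proof (cases "0 \<le> x")
    case True
    have "\<forall>\<^sub>F s in nhds t. ?F s x = \<rho> s x"
      using eventually_nhds_in_open[of "{0<..}" t] t True
      by (auto elim!: eventually_mono simp: zero_extend_def)
    then show ?thesis
      using deriv[OF t True] t True
      by (subst DERIV_cong_ev[OF refl _ refl]) (auto simp: zero_extend_def)
  qed (simp add: zero_extend_def)
  show "ennreal (?G t x) = 2 * (\<integral>\<^sup>+y. ennreal (?F t y) * ennreal (?F t (2 * x - y)) \<partial>lborel)"
  proof (cases "0 \<le> x")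
    case True
    have int: "integrable lborel (\<lambda>y. indicator {0..2 * x} y *\<^sub>R (\<rho> t y * \<rho> t (2 * x - y)))"
      using sol t True by (simp add: classical_solution_def set_integrable_def)
    have "(\<integral>\<^sup>+y. ennreal (?F t y) * ennreal (?F t (2 * x - y)) \<partial>lborel)
        = (\<integral>\<^sup>+y. ennreal (indicator {0..2 * x} y *\<^sub>R (\<rho> t y * \<rho> t (2 * x - y))) \<partial>lborel)"
      using t by (intro nn_integral_cong)
        (auto simp: zero_extend_def nonneg ennreal_mult split: split_indicator)
    also have "\<dots> = ennreal (LBINT y:{0..2 * x}. \<rho> t y * \<rho> t (2 * x - y))"
      unfolding set_lebesgue_integral_def using t
      by (intro nn_integral_eq_integral int) (auto simp: nonneg split: split_indicator)
    finally show ?thesis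
      using t True by (simp add: ennreal_mult')
  next
    case False
    then have "ennreal (?F t y) * ennreal (?F t (2 * x - y)) = 0" for y
      by (simp add: zero_extend_def)
    then have "(\<integral>\<^sup>+y. ennreal (?F t y) * ennreal (?F t (2 * x - y)) \<partial>lborel) = (\<integral>\<^sup>+(y :: real). 0 \<partial>lborel)"
      by (simp only:)
    then show ?thesis using False by simp
  qed
qed

lemma mean_eq_pair_mean:
  assumes "prob_density f"
  shows "mean f = enn2real (pair_mean (density lborel (zero_extend f)) abs_sum) / 2"
proof -
  note [measurable] = prob_density_zero_extend(1)[OF assms]
  let ?M = "density lborel (\<lambda>x. ennreal (zero_extend f x))"
  interpret real_prob_space ?M
    using prob_density_zero_extend[OF assms]
    by (intro real_prob_space.intro real_prob_space_axioms.intro prob_spaceI) (auto simp: emeasure_density)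
  have [simp]: "emeasure ?M UNIV = 1"
    using emeasure_space_1 by simp
  let ?m = "\<integral>\<^sup>+x. ennreal \<bar>x\<bar> \<partial>?M"
  have "pair_mean ?M abs_sum = ?m + ?m"
    unfolding pair_mean_def abs_sum_def by (simp add: nn_integral_add emeasure_space_1)
  moreover have "mean f = enn2real ?m"
  proof -
    have "mean f = integral\<^sup>L lborel (\<lambda>x. zero_extend f x * \<bar>x\<bar>)"
      unfolding mean_def set_lebesgue_integral_def
      by (intro Bochner_Integration.integral_cong) (auto simp: zero_extend_def)
    also have "\<dots> = enn2real (\<integral>\<^sup>+x. ennreal (zero_extend f x * \<bar>x\<bar>) \<partial>lborel)"
      using prob_density_zero_extend(2)[OF assms] by (intro integral_eq_nn_integral) auto
    also have "(\<integral>\<^sup>+x. ennreal (zero_extend f x * \<bar>x\<bar>) \<partial>lborel) = ?m"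
      using prob_density_zero_extend(2)[OF assms] by (subst nn_integral_density) (auto simp: ennreal_mult)
    finally show ?thesis .
  qed
  ultimately show ?thesis
    by (cases ?m) (simp_all add: ennreal_plus[symmetric] del: ennreal_plus)
qed

lemma gini_eq_pair_mean:
  assumes "prob_density f"
  shows "gini f = enn2real (pair_mean (density lborel (zero_extend f)) abs_diff) / (2 * mean f)"
proof -
  note [measurable] = prob_density_zero_extend(1)[OF assms] and nonneg = prob_density_zero_extend(2)[OF assms]
  let ?M = "density lborel (\<lambda>x. ennreal (zero_extend f x))"
  interpret real_prob_space ?M
    using prob_density_zero_extend[OF assms]
    by (intro real_prob_space.intro real_prob_space_axioms.intro prob_spaceI) (auto simp: emeasure_density)
  let ?g = "\<lambda>(x, y). zero_extend f x * zero_extend f y * \<bar>x - y\<bar>"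
  have "set_lebesgue_integral (lborel \<Otimes>\<^sub>M lborel) ({0..} \<times> {0..}) (\<lambda>(x, y). f x * f y * \<bar>x - y\<bar>)
      = integral\<^sup>L (lborel \<Otimes>\<^sub>M lborel) ?g"
    unfolding set_lebesgue_integral_def
    by (intro Bochner_Integration.integral_cong) (auto simp: zero_extend_def indicator_def split: if_splits)
  also have "\<dots> = enn2real (\<integral>\<^sup>+z. ennreal (?g z) \<partial>(lborel \<Otimes>\<^sub>M lborel))"
    using nonneg by (intro integral_eq_nn_integral) auto
  also have "(\<integral>\<^sup>+z. ennreal (?g z) \<partial>(lborel \<Otimes>\<^sub>M lborel)) = (\<integral>\<^sup>+x. \<integral>\<^sup>+y. ennreal (?g (x, y)) \<partial>lborel \<partial>lborel)"
    by (rule lborel.nn_integral_fst[symmetric]) measurable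
  also have "\<dots> = (\<integral>\<^sup>+x. ennreal (zero_extend f x) * (\<integral>\<^sup>+y. ennreal \<bar>x - y\<bar> \<partial>?M) \<partial>lborel)"
  proof (rule nn_integral_cong)
    fix x :: real
    have "(\<integral>\<^sup>+y. ennreal (?g (x, y)) \<partial>lborel)
        = (\<integral>\<^sup>+y. ennreal (zero_extend f x) * (ennreal (zero_extend f y) * ennreal \<bar>x - y\<bar>) \<partial>lborel)"
      using nonneg by (simp add: ennreal_mult mult.assoc)
    then show "(\<integral>\<^sup>+y. ennreal (?g (x, y)) \<partial>lborel)
        = ennreal (zero_extend f x) * (\<integral>\<^sup>+y. ennreal \<bar>x - y\<bar> \<partial>?M)"
      by (simp add: nn_integral_cmult nn_integral_density)
  qed
  also have "\<dots> = pair_mean ?M abs_diff"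
    unfolding pair_mean_def abs_diff_def by (rule nn_integral_density[symmetric]) measurable
  finally show ?thesis
    by (simp add: gini_def)
qed

text \<open>
  On the half-line \<open>abs_sum\<close> is linear, so it measures the mean of the law.
\<close>

lemma triple_mean_defect_abs_sum:
  assumes "real_prob_space M" and pos: "AE x in M. 0 \<le> x"
  shows "triple_mean M (defect abs_sum) = 0"
proof -
  interpret real_prob_space M by fact
  have zero: "ennreal (defect abs_sum x x' y) = 0" if "0 \<le> x" "0 \<le> x'" for x x' y
    using that by (simp add: defect_def at_midpoint_def abs_sum_def field_simps)
  have "triple_mean M (defect abs_sum) = (\<integral>\<^sup>+x. 0 \<partial>M)"
    unfolding triple_mean_def
  proof (rule nn_integral_cong_AE, use pos in eventually_elim)
    fix x :: real assume x: "0 \<le> x"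
    have "(\<integral>\<^sup>+x'. \<integral>\<^sup>+y. ennreal (defect abs_sum x x' y) \<partial>M \<partial>M) = (\<integral>\<^sup>+x'. 0 \<partial>M)"
      by (rule nn_integral_cong_AE, use pos in eventually_elim) (simp add: zero x)
    then show "(\<integral>\<^sup>+x'. \<integral>\<^sup>+y. ennreal (defect abs_sum x x' y) \<partial>M \<partial>M) = 0" by simp
  qed
  then show ?thesis by simp
qed

section \<open>Decay of the Gini index\<close>

text \<open>
  Young's inequality \<open>\<bar>z\<bar> \<le> z\<^sup>2 / (2 * l) + l / 2\<close> with a free length \<open>l\<close> replaces the Cauchy-Schwarz
  inequality.
\<close>

lemma (in real_prob_space) abs_diff_le_sq_diff:
  assumes Q: "pair_mean M sq_diff \<le> ennreal Q" "0 \<le> Q" and l: "0 < l"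
  shows "pair_mean M abs_diff \<le> ennreal (Q / (2 * l) + l / 2)"
proof -
  note [measurable] = symmetric_kernel_measurable[OF symmetric_kernel_sq_diff]
  define c where "c = 1 / (2 * l)"
  have c: "0 \<le> c" using l by (simp add: c_def)
  have young: "abs_diff x y \<le> c * sq_diff x y + l / 2" for x y
  proof -
    have "0 \<le> c * (\<bar>x - y\<bar> - l)\<^sup>2" using c by simp
    also have "\<dots> = c * sq_diff x y + l / 2 - abs_diff x y"
      using l by (simp add: c_def power2_diff sq_diff_def abs_diff_def divide_simps)
        (simp add: algebra_simps power2_eq_square)
    finally show ?thesis by simp
  qed
  have "ennreal (abs_diff x y) \<le> ennreal c * ennreal (sq_diff x y) + ennreal (l / 2)" for x y
    using ennreal_leI[OF young[of x y]] c l symmetric_kernel_nonneg[OF symmetric_kernel_sq_diff, of x y]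
    by (simp add: ennreal_plus ennreal_mult)
  then have "pair_mean M abs_diff
      \<le> (\<integral>\<^sup>+x. \<integral>\<^sup>+y. ennreal c * ennreal (sq_diff x y) + ennreal (l / 2) \<partial>M \<partial>M)"
    unfolding pair_mean_def by (intro nn_integral_mono)
  also have "\<dots> = ennreal c * pair_mean M sq_diff + ennreal (l / 2)"
    unfolding pair_mean_def by (simp add: nn_integral_add nn_integral_cmult emeasure_space_1)
  also have "\<dots> \<le> ennreal c * ennreal Q + ennreal (l / 2)"
    by (intro add_mono mult_left_mono Q) auto
  also have "\<dots> = ennreal (Q / (2 * l) + l / 2)"
    using l Q by (simp add: c_def ennreal_mult[symmetric] ennreal_plus[symmetric] del: ennreal_plus)
  finally show ?thesis .
qed

lemma exp_rate_early:
  fixes t :: real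
  assumes "0 \<le> t" "t \<le> 21"
  shows "1 - (1 - exp (- (3 * t))) / 216 \<le> exp (- t / 14434)"
proof -
  have "exp (- (3 * t)) = 1 / exp (3 * t)" by (simp add: exp_minus field_simps)
  also have "\<dots> \<le> 1 / (1 + 3 * t)"
    using assms by (intro divide_left_mono exp_ge_add_one_self) auto
  also have "\<dots> \<le> 1 - 3 * t / 64"
  proof -
    have "t * t \<le> t * 21" using assms by (intro mult_left_mono) auto
    then show ?thesis using assms by (simp add: field_simps)
  qed
  finally have "1 - (1 - exp (- (3 * t))) / 216 \<le> 1 - t / 14434"
    using assms by (simp add: field_simps)
  also have "\<dots> \<le> exp (- t / 14434)"
    using exp_ge_add_one_self[of "- t / 14434"] by simp
  finally show ?thesis .
qed

text \<open>
  From time \<open>21\<close> on, the difference of the two rates times \<open>t\<close> is at least \<open>5\<close>, and \<open>exp 5 \<ge> 2 ^ 5\<close>.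
\<close>

lemma exp_rate_late:
  fixes t :: real
  assumes "21 \<le> t"
  shows "26 * exp (- t / 4) \<le> exp (- t / 14434)"
proof -
  have "(2::real) ^ 5 \<le> exp 1 ^ 5"
    using exp_ge_add_one_self[of 1] by (intro power_mono) auto
  then have "26 \<le> exp (5::real)"
    by (simp add: exp_of_nat_mult[symmetric])
  also have "\<dots> \<le> exp (t / 4 - t / 14434)"
    using assms by simp
  finally have "26 * exp (- t / 4) \<le> exp (t / 4 - t / 14434) * exp (- t / 4)"
    by (intro mult_right_mono) auto
  then show ?thesis by (simp add: exp_add[symmetric])
qed

text \<open>
  The mean is constant, so the Gini index is a constant multiple of the mean distance \<open>D\<close>. Up to time
  \<open>21\<close> the bound comes from the defect of the initial law, which gives decay with the
  constant one in front but saturates. After time \<open>21\<close> it comes from the variance, whose decay is fast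
  enough by then to make up for the constant \<open>26\<close> lost in comparing first and second moments.
\<close>

lemma gini_exponential_bound:
  assumes prob: "\<And>t. t \<ge> 0 \<Longrightarrow> prob_density (\<rho> t)"
    and sol: "classical_solution \<rho>" and lc: "log_concave (\<rho> 0)"
    and mean: "has_mean (\<rho> 0) \<mu>" and \<mu>: "\<mu> > 0" and t: "0 \<le> t"
  shows "gini (\<rho> t) \<le> gini (\<rho> 0) * exp (- t / 14434)"
proof -
  interpret flow: averaging_densities "\<lambda>t. zero_extend (\<rho> (max 0 t))"
    "\<lambda>t x. if 0 < t \<and> 0 \<le> x then 2 * (LBINT y:{0..2 * x}. \<rho> t y * \<rho> t (2 * x - y)) else 0"
    by (rule averaging_densities_of_classical_solution[OF prob sol])
  interpret init: log_concave_law "zero_extend (\<rho> 0)"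
    by (rule log_concave_law_zero_extend[OF prob lc]) simp
  have law: "flow.law s = density lborel (zero_extend (\<rho> s))" if "0 \<le> s" for s
    using that by (simp add: flow.law_def max_absorb2)
  have law0: "flow.law 0 = init.law"
    by (simp add: flow.law_def init.law_def)
  have D_le_sum: "pair_mean M abs_diff \<le> pair_mean M abs_sum" for M
    unfolding pair_mean_def abs_diff_def abs_sum_def by (intro nn_integral_mono ennreal_leI) auto
  have sum_fin: "pair_mean (flow.law 0) abs_sum < top"
  proof -
    let ?x = "\<lambda>x. zero_extend (\<rho> 0) x * \<bar>x\<bar>"
    have nonneg: "0 \<le> zero_extend (\<rho> 0) x" for x by (rule init.f_nonneg)
    have "integrable lborel ?x"
      using mean unfolding has_mean_def set_integrable_def
      by (elim conjE, subst (asm) Bochner_Integration.integrable_cong[OF refl, of _ _ ?x])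
        (auto simp: zero_extend_def)
    then have "(\<integral>\<^sup>+x. ennreal (?x x) \<partial>lborel) < top"
      using nonneg by (subst nn_integral_eq_integral) auto
    then have "(\<integral>\<^sup>+x. ennreal \<bar>x\<bar> \<partial>init.law) < top"
      using nonneg by (subst init.nn_integral_law) (auto simp: ennreal_mult)
    moreover have "pair_mean init.law abs_sum = (\<integral>\<^sup>+x. ennreal \<bar>x\<bar> \<partial>init.law) + (\<integral>\<^sup>+x. ennreal \<bar>x\<bar> \<partial>init.law)"
      unfolding pair_mean_def abs_sum_def by (simp add: nn_integral_add init.emeasure_space_1)
    ultimately show ?thesis by (simp add: law0)
  qed
  have sum_const: "pair_mean (flow.law s) abs_sum = pair_mean (flow.law 0) abs_sum" if "0 \<le> s" for s
  proof (rule antisym)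
    show "pair_mean (flow.law s) abs_sum \<le> pair_mean (flow.law 0) abs_sum"
      by (rule flow.pair_mean_nonincreasing[OF symmetric_kernel_abs_sum midpoint_convex_abs_sum that])
    have "AE x in flow.law s. 0 \<le> x" for s
      using flow.F_measurable[of s] unfolding flow.law_def
      by (subst AE_density) (simp, auto simp: zero_extend_def)
    then show "pair_mean (flow.law 0) abs_sum \<le> pair_mean (flow.law s) abs_sum"
      by (intro flow.pair_mean_nondecreasing symmetric_kernel_abs_sum midpoint_convex_abs_sum sum_fin that
          triple_mean_defect_abs_sum flow.real_prob_space_law)
  qed
  have mean_const: "mean (\<rho> s) = \<mu>" if "0 \<le> s" for s
    using mean_eq_pair_mean[OF prob[OF that]] mean_eq_pair_mean[OF prob[of 0]] mean sum_const[OF that]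
    by (simp add: law[OF that, symmetric] law[of 0, symmetric] has_mean_def)
  define D where "D s = enn2real (pair_mean (flow.law s) abs_diff)" for s
  have D0_fin: "pair_mean (flow.law 0) abs_diff < top"
    using D_le_sum sum_fin by (rule le_less_trans)
  have D0: "pair_mean init.law abs_diff = ennreal (D 0)"
    using D0_fin by (simp add: D_def law0)
  have D_nonneg: "0 \<le> D s" for s by (simp add: D_def)
  have gini: "gini (\<rho> s) = D s / (2 * \<mu>)" if "0 \<le> s" for s
    using gini_eq_pair_mean[OF prob[OF that]] mean_const[OF that] by (simp add: D_def law[OF that])
  have "D t \<le> D 0 * exp (- t / 14434)"
  proof (cases "D 0 = 0")
    case True
    have "D t \<le> D 0"
      unfolding D_def
      by (intro enn2real_mono flow.pair_mean_nonincreasing symmetric_kernel_abs_diff midpoint_convex_abs_diff t D0_fin)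
    then show ?thesis using True by simp
  next
    case False
    then have D_pos: "0 < D 0" using D_nonneg[of 0] by simp
    consider "t \<le> 21" | "21 \<le> t" by linarith
    then show ?thesis
    proof cases
      case 1
      define g where "g = D 0 / 144"
      have "exp (2 * t) * D t \<le> D 0 * exp (2 * (1 - 0) * t)
          - 2 * g * (exp (2 * (1 - 0) * t) - exp (- t)) / (2 * (1 - 0) + 1)"
        unfolding D_def
      proof (rule flow.pair_mean_decay[OF symmetric_kernel_abs_diff midpoint_convex_abs_diff D0_fin _ _ _ _ t])
        fix s :: real assume s: "0 \<le> s"
        have "ennreal (0 * enn2real (pair_mean (flow.law s) abs_diff) + g * exp (- 3 * s))
            = ennreal (exp (- 3 * s)) * ennreal g"
          by (simp add: ennreal_mult'' mult.commute)
        also have "\<dots> \<le> ennreal (exp (- 3 * s)) * triple_mean (flow.law 0) (defect abs_diff)"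
          unfolding g_def law0 by (intro mult_left_mono init.defect_abs_diff_ge D0 D_pos) simp
        also have "\<dots> \<le> triple_mean (flow.law s) (defect abs_diff)"
          by (rule flow.triple_mean_defect_lower_bound[OF symmetric_kernel_abs_diff s])
        finally show "ennreal (0 * enn2real (pair_mean (flow.law s) abs_diff) + g * exp (- 3 * s))
            \<le> triple_mean (flow.law s) (defect abs_diff)" .
      qed (use D_pos in \<open>auto simp: g_def\<close>)
      also have "\<dots> = exp (2 * t) * (D 0 * (1 - (1 - exp (- (3 * t))) / 216))"
        by (simp add: g_def field_simps exp_add[symmetric])
      finally have "D t \<le> D 0 * (1 - (1 - exp (- (3 * t))) / 216)" by simp
      also have "\<dots> \<le> D 0 * exp (- t / 14434)"
        using exp_rate_early[OF t 1] D_pos by (intro mult_left_mono) auto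
      finally show ?thesis .
    next
      case 2
      define Q where "Q s = enn2real (pair_mean (flow.law s) sq_diff)" for s
      have Q0_le: "pair_mean (flow.law 0) sq_diff \<le> ennreal (648 * (D 0)\<^sup>2)"
        unfolding law0 by (rule init.sq_diff_le_abs_diff[OF D0 D_pos])
      then have Q0_fin: "pair_mean (flow.law 0) sq_diff < top"
        by (rule le_less_trans) simp
      have Q_eq: "ennreal (Q s) = pair_mean (flow.law s) sq_diff" if "0 \<le> s" for s
        using le_less_trans[OF flow.pair_mean_nonincreasing[OF symmetric_kernel_sq_diff midpoint_convex_sq_diff that] Q0_fin]
        by (simp add: Q_def)
      have Q0: "Q 0 \<le> 648 * (D 0)\<^sup>2"
        using Q0_le unfolding Q_eq[OF order_refl, symmetric] by (subst (asm) ennreal_le_iff) auto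
      have "exp (2 * t) * Q t \<le> Q 0 * exp (2 * (1 - 1 / 4) * t)
          - 2 * 0 * (exp (2 * (1 - 1 / 4) * t) - exp (- t)) / (2 * (1 - 1 / 4) + 1)"
        unfolding Q_def
      proof (rule flow.pair_mean_decay[OF symmetric_kernel_sq_diff midpoint_convex_sq_diff Q0_fin _ _ _ _ t])
        fix s :: real assume s: "0 \<le> s"
        interpret L: real_prob_space "flow.law s" by (rule flow.real_prob_space_law)
        note [measurable] = symmetric_kernel_measurable[OF symmetric_kernel_sq_diff]
        \<comment> \<open>The defect of the squared distance depends on two of the three points only.\<close>
        have "ennreal (1 / 4 * Q s) = ennreal (1 / 4) * pair_mean (flow.law s) sq_diff"
          by (simp add: ennreal_mult'[symmetric] Q_eq[OF s, symmetric])
        also have "\<dots> = ennreal (1 / 4) * triple_mean (flow.law s) (\<lambda>x x' y. sq_diff x x')"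
          by (simp add: pair_mean_triple(3)[OF flow.real_prob_space_law symmetric_kernel_sq_diff])
        also have "\<dots> = triple_mean (flow.law s) (defect sq_diff)"
        proof -
          have "ennreal (sq_diff x x' / 4) = ennreal (1 / 4) * ennreal (sq_diff x x')" for x x'
            by (simp add: ennreal_mult'[symmetric])
          then show ?thesis
            by (simp add: triple_mean_def defect_sq_diff L.emeasure_space_1 nn_integral_cmult)
        qed
        finally show "ennreal (1 / 4 * enn2real (pair_mean (flow.law s) sq_diff) + 0 * exp (- 3 * s))
            \<le> triple_mean (flow.law s) (defect sq_diff)"
          by (simp add: Q_def)
      qed auto
      also have "\<dots> = exp (2 * t) * (Q 0 * exp (- t / 2))"
        by (simp add: exp_add[symmetric])
      finally have "Q t \<le> Q 0 * exp (- t / 2)" by simp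
      also have "\<dots> \<le> 648 * (D 0)\<^sup>2 * exp (- t / 2)"
        using Q0 by (intro mult_right_mono) auto
      finally have Qt: "Q t \<le> 648 * (D 0)\<^sup>2 * exp (- t / 2)" .
      \<comment> \<open>Nearly optimal in Young's inequality: the two terms become 12.96 and 12.5 times the same quantity.\<close>
      define l where "l = 25 * D 0 * exp (- t / 4)"
      have l: "0 < l" using D_pos by (simp add: l_def)
      interpret L: real_prob_space "flow.law t" by (rule flow.real_prob_space_law)
      have "pair_mean (flow.law t) abs_diff \<le> ennreal (648 * (D 0)\<^sup>2 * exp (- t / 2) / (2 * l) + l / 2)"
        by (rule L.abs_diff_le_sq_diff) (use Qt l Q_eq[OF t] in \<open>auto intro: ennreal_leI simp flip: Q_eq[OF t]\<close>)
      then have "D t \<le> 648 * (D 0)\<^sup>2 * exp (- t / 2) / (2 * l) + l / 2"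
        unfolding D_def using l by (intro enn2real_leI) auto
      also have "\<dots> \<le> 26 * D 0 * exp (- t / 4)"
      proof -
        define q where "q = D 0 * exp (- t / 4)"
        have "exp (- t / 2) = exp (- t / 4) * exp (- t / 4)" by (simp add: exp_add[symmetric])
        then have "648 * (D 0)\<^sup>2 * exp (- t / 2) = 648 * (q * q)" and "l = 25 * q"
          by (simp_all add: q_def l_def power2_eq_square)
        moreover have "0 < q" using D_pos by (simp add: q_def)
        ultimately show ?thesis unfolding mult.assoc q_def[symmetric] by simp
      qed
      also have "\<dots> = D 0 * (26 * exp (- t / 4))" by simp
      also have "\<dots> \<le> D 0 * exp (- t / 14434)"
        using exp_rate_late[OF 2] D_pos by (intro mult_left_mono) auto
      finally show ?thesis .
    qed
  qed
  then show ?thesis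
    using \<mu> gini[OF t] gini[of 0] by (simp add: divide_right_mono)
qed

theorem theorem2:
  fixes \<rho> :: "real \<Rightarrow> real \<Rightarrow> real" and \<mu> :: real
  assumes "\<And>t. t \<ge> 0 \<Longrightarrow> prob_density (\<rho> t)"
    and "classical_solution \<rho>"
    and "log_concave (\<rho> 0)"
    and "has_mean (\<rho> 0) \<mu>"
    and "\<mu> > 0"
  shows "((\<lambda>t. gini (\<rho> t)) \<longlongrightarrow> 0) at_top \<and>
         (\<forall>t\<ge>0. gini (\<rho> t) \<le> gini (\<rho> 0) * exp (- t / 14434))"
proof
  have bound: "gini (\<rho> t) \<le> gini (\<rho> 0) * exp (- t / 14434)" if "0 \<le> t" for t
    using gini_exponential_bound[OF assms that] .
  then show "\<forall>t\<ge>0. gini (\<rho> t) \<le> gini (\<rho> 0) * exp (- t / 14434)" by blast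
  have nonneg: "0 \<le> gini (\<rho> t)" if "0 \<le> t" for t
    unfolding gini_eq_pair_mean[OF assms(1)[OF that]] mean_eq_pair_mean[OF assms(1)[OF that]] by simp
  show "((\<lambda>t. gini (\<rho> t)) \<longlongrightarrow> 0) at_top"
  proof (rule tendsto_sandwich)
    show "\<forall>\<^sub>F t in at_top. 0 \<le> gini (\<rho> t)"
      using eventually_ge_at_top[of 0] by eventually_elim (rule nonneg)
    show "\<forall>\<^sub>F t in at_top. gini (\<rho> t) \<le> gini (\<rho> 0) * exp (- t / 14434)"
      using eventually_ge_at_top[of 0] by eventually_elim (rule bound)
    have "LIM t at_top. (1 / 14434 :: real) * t :> at_top"
      by (rule filterlim_tendsto_pos_mult_at_top[OF tendsto_const _ filterlim_ident]) simp
    then have "LIM t at_top. t / 14434 :> (at_top :: real filter)" by simp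
    then have "((\<lambda>t. exp (- (t / 14434))) \<longlongrightarrow> (0::real)) at_top"
      by (intro filterlim_compose[OF exp_at_bot] filterlim_compose[OF filterlim_uminus_at_bot_at_top])
    from tendsto_mult_right_zero[OF this]
    show "((\<lambda>t. gini (\<rho> 0) * exp (- t / 14434)) \<longlongrightarrow> 0) at_top" by simp
  qed simp
qed

end
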